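(* Let $m\ge 1$ be an integer. If for some integer $\Delta$ there exists an $m$-$\gamma_t$-critical graph $G$ with $\Delta(G)=\Delta$, $\delta(G)\ge 2$ and order $\Delta+m$, then $m=4$ or $m\ge 3$ is odd. Conversely, suppose $m=4$ or $m\ge 3$ is odd. Then: (1) if $\Delta<2\lfloor\frac{m-1}{2}\rfloor$, there is no $m$-$\gamma_t$-critical graph $G$ with $\Delta(G)=\Delta$, $\delta(G)\ge 2$ and order $\Delta+m$; (2) for every even $\Delta\ge 2\lfloor\frac{m-1}{2}\rfloor$ there exists an $m$-$\gamma_t$-critical graph $G$ with $\Delta(G)=\Delta$, $\delta(G)\ge 2$ and order $\Delta+m$; (3) for every odd $\Delta\ge 2\lfloor\frac{m-1}{2}\rfloor+7$ there exists an $m$-$\gamma_t$-critical graph $G$ with $\Delta(G)=\Delta$, $\delta(G)\ge 2$ and order $\Delta+m$.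
   Context: All graphs are finite and simple. For a graph $G$, $\Delta(G)$ and $\delta(G)$ denote the maximum and minimum degree, and the order is $|V(G)|$. A set $S\subseteq V(G)$ is a total dominating set if every vertex of $G$ (including those in $S$) is adjacent to some vertex of $S$; the total domination number $\gamma_t(G)$ is the minimum size of a total dominating set (defined for graphs without isolated vertices). A leaf is a vertex of degree one. A graph $G$ with no isolated vertex is $\gamma_t$-critical (total domination vertex critical) if for every vertex $v$ of $G$ that is not adjacent to a leaf, $\gamma_t(G-v)<\gamma_t(G)$; it is $m$-$\gamma_t$-critical if moreover $\gamma_t(G)=m$. *)

theory Defs
  imports Main
begin

definition graph :: "'a set \<Rightarrow> ('a \<Rightarrow> 'a \<Rightarrow> bool) \<Rightarrow> bool" where
  "graph V E \<longleftrightarrow> finite V \<and> (\<forall>u v. E u v \<longrightarrow> u \<in> V \<and> v \<in> V)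
     \<and> (\<forall>u v. E u v \<longrightarrow> E v u) \<and> (\<forall>v. \<not> E v v)"

definition nbrs :: "'a set \<Rightarrow> ('a \<Rightarrow> 'a \<Rightarrow> bool) \<Rightarrow> 'a \<Rightarrow> 'a set" where
  "nbrs V E v = {u \<in> V. E v u}"

definition degree :: "'a set \<Rightarrow> ('a \<Rightarrow> 'a \<Rightarrow> bool) \<Rightarrow> 'a \<Rightarrow> nat" where
  "degree V E v = card (nbrs V E v)"

definition max_degree :: "'a set \<Rightarrow> ('a \<Rightarrow> 'a \<Rightarrow> bool) \<Rightarrow> nat" where
  "max_degree V E = Max (degree V E ` V)"

definition min_degree :: "'a set \<Rightarrow> ('a \<Rightarrow> 'a \<Rightarrow> bool) \<Rightarrow> nat" where
  "min_degree V E = Min (degree V E ` V)"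

definition del_vertex_V :: "'a set \<Rightarrow> 'a \<Rightarrow> 'a set" where
  "del_vertex_V V v = V - {v}"

definition del_vertex_E :: "('a \<Rightarrow> 'a \<Rightarrow> bool) \<Rightarrow> 'a \<Rightarrow> 'a \<Rightarrow> 'a \<Rightarrow> bool" where
  "del_vertex_E E v = (\<lambda>x y. E x y \<and> x \<noteq> v \<and> y \<noteq> v)"

definition no_isolated :: "'a set \<Rightarrow> ('a \<Rightarrow> 'a \<Rightarrow> bool) \<Rightarrow> bool" where
  "no_isolated V E \<longleftrightarrow> (\<forall>v\<in>V. \<exists>u\<in>V. E v u)"

definition is_leaf :: "'a set \<Rightarrow> ('a \<Rightarrow> 'a \<Rightarrow> bool) \<Rightarrow> 'a \<Rightarrow> bool" where
  "is_leaf V E v \<longleftrightarrow> v \<in> V \<and> degree V E v = 1"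

definition total_dom_set :: "'a set \<Rightarrow> ('a \<Rightarrow> 'a \<Rightarrow> bool) \<Rightarrow> 'a set \<Rightarrow> bool" where
  "total_dom_set V E S \<longleftrightarrow> S \<subseteq> V \<and> (\<forall>v\<in>V. \<exists>u\<in>S. E v u)"

definition gamma_t :: "'a set \<Rightarrow> ('a \<Rightarrow> 'a \<Rightarrow> bool) \<Rightarrow> nat" where
  "gamma_t V E = (LEAST k. \<exists>S. total_dom_set V E S \<and> card S = k)"

definition gamma_t_critical :: "'a set \<Rightarrow> ('a \<Rightarrow> 'a \<Rightarrow> bool) \<Rightarrow> bool" where
  "gamma_t_critical V E \<longleftrightarrow> no_isolated V E \<and>
     (\<forall>v\<in>V. (\<not> (\<exists>u\<in>V. E v u \<and> is_leaf V E u)) \<longrightarrow>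
        gamma_t (del_vertex_V V v) (del_vertex_E E v) < gamma_t V E)"

definition m_gamma_t_critical :: "nat \<Rightarrow> 'a set \<Rightarrow> ('a \<Rightarrow> 'a \<Rightarrow> bool) \<Rightarrow> bool" where
  "m_gamma_t_critical m V E \<longleftrightarrow> gamma_t_critical V E \<and> gamma_t V E = m"

definition good_graph :: "nat \<Rightarrow> nat \<Rightarrow> 'a set \<Rightarrow> ('a \<Rightarrow> 'a \<Rightarrow> bool) \<Rightarrow> bool" where
  "good_graph m D V E \<longleftrightarrow> graph V E \<and> m_gamma_t_critical m V E \<and>
     max_degree V E = D \<and> min_degree V E \<ge> 2 \<and> card V = D + m"

end

theory Submission
  imports Defs
begin

text \<open>Let \<open>v\<close> have maximum degree. A smallest total dominating set of \<open>G - v\<close> has \<open>m - 1\<close> elements and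
  avoids \<open>N(v)\<close>, so by the order of \<open>G\<close> it is the whole set \<open>S\<close> of non-neighbours of \<open>v\<close>. Given
  \<open>u \<in> N(v)\<close>, dominating \<open>S - N(u)\<close> together with \<open>u\<close> and \<open>v\<close> costs at least \<open>m\<close>. Hence \<open>u\<close> has
  exactly one neighbour \<open>x\<close> in \<open>S\<close>, and no two elements of \<open>S - {x}\<close> have a common neighbour. If
  every element of \<open>S\<close> is such an \<open>x\<close>, then \<open>S\<close> induces a perfect matching and injects into
  \<open>N(v)\<close>; otherwise \<open>|S| = 3\<close>.

  Conversely, for \<open>m = 3\<close> and \<open>m = 4\<close> criticality becomes a condition on the graph induced on \<open>N(v)\<close>,
  split into the neighbourhoods of two vertices of \<open>S\<close>. The condition survives adding one vertex to
  each side, each joined to all old vertices of the other side, so one solution with two vertices and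
  one with nine give every degree. Gluing a 5-cycle at \<open>v\<close> raises \<open>m\<close> and the degree of \<open>v\<close> by
  two.\<close>

section \<open>Total domination and criticality\<close>

text \<open>The target \<open>X\<close> is kept apart from \<open>V\<close>, since the argument
  often dominates all vertices but one, or a single side of a bipartition.\<close>

definition dominates :: "('a \<Rightarrow> 'a \<Rightarrow> bool) \<Rightarrow> 'a set \<Rightarrow> 'a set \<Rightarrow> bool" where
  "dominates E T X \<longleftrightarrow> (\<forall>x\<in>X. \<exists>t\<in>T. E x t)"

lemma total_dom_set_iff: "total_dom_set V E T \<longleftrightarrow> T \<subseteq> V \<and> dominates E T V"
  by (simp add: total_dom_set_def dominates_def)

text \<open>An edge from \<open>V - {w}\<close> to \<open>T\<close> avoids \<open>w\<close> at both
  ends, so \<open>E\<close> itself can replace the edge relation of the smaller graph.\<close>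

lemma total_dom_set_del_iff:
  "total_dom_set (del_vertex_V V w) (del_vertex_E E w) T \<longleftrightarrow>
     T \<subseteq> V - {w} \<and> dominates E T (V - {w})"
  by (auto simp: total_dom_set_def dominates_def del_vertex_V_def del_vertex_E_def)

lemma gamma_t_le: "total_dom_set V E T \<Longrightarrow> gamma_t V E \<le> card T"
  unfolding gamma_t_def by (rule Least_le) blast

text \<open>\<open>LEAST\<close> is a true minimum only where some total dominating set exists;
  hence the assumption.\<close>

lemma gamma_t_attained:
  assumes "total_dom_set V E T"
  shows "\<exists>S. total_dom_set V E S \<and> card S = gamma_t V E"
  unfolding gamma_t_def
proof (rule LeastI)
  show "\<exists>S. total_dom_set V E S \<and> card S = card T" using assms by blast
qed

lemma degree_eq_card:
  assumes "graph V E"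
  shows "degree V E v = card {u. E v u}"
proof -
  have "nbrs V E v = {u. E v u}" using assms by (auto simp: nbrs_def graph_def)
  then show ?thesis by (simp add: degree_def)
qed

lemma two_neighbours:
  assumes "degree V E v \<ge> 2"
  shows "\<exists>a\<in>V. \<exists>b\<in>V. a \<noteq> b \<and> E v a \<and> E v b"
proof -
  obtain T where T: "T \<subseteq> nbrs V E v" "card T = 2"
    by (rule obtain_subset_with_card_n[OF assms[unfolded degree_def]])
  then obtain a b where "T = {a, b}" "a \<noteq> b" by (auto simp: card_2_iff)
  with T have "a \<in> nbrs V E v" "b \<in> nbrs V E v" by simp_all
  with \<open>a \<noteq> b\<close> show ?thesis unfolding nbrs_def by blast
qed

text \<open>Replaces \<open>LEAST\<close> by statements about explicit sets. Minimum degree two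
  leaves no leaves, so criticality concerns every vertex. The witness for \<open>v\<close> together
  with a neighbour of \<open>v\<close> also shows that \<open>m\<close> vertices suffice for the
  whole graph.\<close>

lemma good_graphI:
  assumes g: "graph V E" and v: "v \<in> V" "degree V E v = D"
    and deg: "\<And>u. u \<in> V \<Longrightarrow> 2 \<le> degree V E u \<and> degree V E u \<le> D"
    and card: "card V = D + m"
    and lower: "\<And>T. T \<subseteq> V \<Longrightarrow> dominates E T V \<Longrightarrow> m \<le> card T"
    and crit: "\<And>w. w \<in> V \<Longrightarrow> \<exists>T \<subseteq> V - {w}. dominates E T (V - {w}) \<and> card T < m"
  shows "good_graph m D V E"
proof -
  have fin: "finite V" and ne: "V \<noteq> {}" using g v by (auto simp: graph_def)
  have iso: "no_isolated V E"
    unfolding no_isolated_def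
  proof
    fix x assume "x \<in> V"
    then show "\<exists>u\<in>V. E x u" using deg[of x] two_neighbours[of V E x] by blast
  qed
  obtain u where u: "u \<in> V" "E v u" using deg[OF v(1)] two_neighbours[of V E v] by blast
  obtain T where T: "T \<subseteq> V - {v}" "dominates E T (V - {v})" "card T < m"
    using crit[OF v(1)] by blast
  have "dominates E (insert u T) V" unfolding dominates_def
  proof
    fix x assume "x \<in> V"
    then show "\<exists>t\<in>insert u T. E x t"
      using T(2) u(2) by (cases "x = v") (simp_all add: dominates_def)
  qed
  then have tot: "total_dom_set V E (insert u T)" using T u by (auto simp: total_dom_set_iff)
  have "card (insert u T) \<le> m" using T card_insert_le_m1[of m T u] by linarith
  then have "gamma_t V E \<le> m" using gamma_t_le[OF tot] by linarith
  moreover have "m \<le> gamma_t V E"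
  proof -
    obtain S where "total_dom_set V E S" "card S = gamma_t V E"
      using gamma_t_attained[OF tot] by blast
    then show ?thesis using lower[of S] by (simp add: total_dom_set_iff)
  qed
  ultimately have gam: "gamma_t V E = m" by simp
  have "gamma_t (del_vertex_V V w) (del_vertex_E E w) < m" if w: "w \<in> V" for w
  proof -
    obtain T where "T \<subseteq> V - {w}" "dominates E T (V - {w})" "card T < m"
      using crit[OF w] by blast
    then show ?thesis
      using gamma_t_le[of "del_vertex_V V w" "del_vertex_E E w" T]
      by (simp add: total_dom_set_del_iff)
  qed
  then have "gamma_t_critical V E"
    unfolding gamma_t_critical_def gam using iso by blast
  moreover have "max_degree V E = D"
    unfolding max_degree_def
  proof (rule Max_eqI)
    show "finite (degree V E ` V)" using fin by simp
    show "D \<in> degree V E ` V" using v by (metis imageI)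
    show "d \<le> D" if "d \<in> degree V E ` V" for d using that deg by (elim imageE) simp
  qed
  moreover have "min_degree V E \<ge> 2"
    unfolding min_degree_def
  proof (rule Min.boundedI)
    show "finite (degree V E ` V)" "degree V E ` V \<noteq> {}" using fin ne by simp_all
    show "2 \<le> d" if "d \<in> degree V E ` V" for d using that deg by (elim imageE) simp
  qed
  ultimately show ?thesis
    using g gam card by (simp add: good_graph_def m_gamma_t_critical_def)
qed

text \<open>The converse of \<open>good_graphI\<close>: as there are no leaves, no vertex is exempt
  from criticality.\<close>

lemma good_graphD:
  assumes "good_graph m D V E"
  shows "graph V E" "card V = D + m"
    and "u \<in> V \<Longrightarrow> 2 \<le> degree V E u \<and> degree V E u \<le> D"
    and "T \<subseteq> V \<Longrightarrow> dominates E T V \<Longrightarrow> m \<le> card T"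
    and "w \<in> V \<Longrightarrow> \<exists>T \<subseteq> V - {w}. dominates E T (V - {w}) \<and> card T < m"
proof -
  show g: "graph V E" and "card V = D + m" using assms by (auto simp: good_graph_def)
  then have fin: "finite V" by (auto simp: graph_def)
  have gam: "gamma_t V E = m" using assms by (auto simp: good_graph_def m_gamma_t_critical_def)
  show deg: "2 \<le> degree V E u \<and> degree V E u \<le> D" if "u \<in> V" for u
  proof
    have "2 \<le> min_degree V E" using assms by (auto simp: good_graph_def)
    also have "\<dots> \<le> degree V E u" unfolding min_degree_def using fin that by (intro Min_le) auto
    finally show "2 \<le> degree V E u" .
    have "degree V E u \<le> max_degree V E"
      unfolding max_degree_def using fin that by (intro Max_ge) auto
    then show "degree V E u \<le> D" using assms by (auto simp: good_graph_def)
  qed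
  show "m \<le> card T" if "T \<subseteq> V" "dominates E T V"
    using gamma_t_le[of V E T] gam that by (simp add: total_dom_set_iff)
  show "\<exists>T \<subseteq> V - {w}. dominates E T (V - {w}) \<and> card T < m" if w: "w \<in> V"
  proof -
    have "\<not> (\<exists>u\<in>V. E w u \<and> is_leaf V E u)" 
    proof
      assume "\<exists>u\<in>V. E w u \<and> is_leaf V E u"
      then obtain u where "u \<in> V" "degree V E u = 1" by (auto simp: is_leaf_def)
      then show False using deg[of u] by simp
    qed
    then have less: "gamma_t (del_vertex_V V w) (del_vertex_E E w) < m"
      using assms w gam unfolding good_graph_def m_gamma_t_critical_def gamma_t_critical_def by blast
    \<comment> \<open>Each vertex has two neighbours, so one survives the deletion; the smaller
      graph thus has total dominating sets and its \<open>gamma_t\<close> is attained.\<close>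
    have "dominates E (V - {w}) (V - {w})" unfolding dominates_def
    proof
      fix x assume x: "x \<in> V - {w}"
      then obtain a b where "a \<noteq> b" "E x a" "E x b"
        using deg[of x] two_neighbours[of V E x] by blast
      then show "\<exists>t\<in>V - {w}. E x t" using g unfolding graph_def by blast
    qed
    then have "total_dom_set (del_vertex_V V w) (del_vertex_E E w) (V - {w})"
      by (simp add: total_dom_set_del_iff)
    then obtain T where "total_dom_set (del_vertex_V V w) (del_vertex_E E w) T"
      "card T = gamma_t (del_vertex_V V w) (del_vertex_E E w)"
      using gamma_t_attained by blast
    with less show ?thesis unfolding total_dom_set_del_iff by (intro exI[of _ T]) simp
  qed
qed

text \<open>The order \<open>D + m\<close> is positive, so \<open>V\<close> is nonempty and
  \<open>Max\<close> is attained.\<close>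

lemma good_graph_max_degree_vertex:
  assumes "good_graph m D V E" "m \<ge> 1"
  obtains v where "v \<in> V" "degree V E v = D"
proof -
  have "finite V" "max_degree V E = D" "V \<noteq> {}"
    using assms by (auto simp: good_graph_def graph_def)
  then have "D \<in> degree V E ` V" unfolding max_degree_def using Max_in by blast
  then show ?thesis using that by (elim imageE) simp
qed

section \<open>The vertices outside a largest closed neighbourhood\<close>

text \<open>The pairs \<open>{x, f x}\<close> partition \<open>S\<close> into classes of size
  two.\<close>

lemma even_card_perfect_matching:
  assumes fin: "finite S" and inv: "\<And>x. x \<in> S \<Longrightarrow> f x \<in> S \<and> f x \<noteq> x \<and> f (f x) = x"
  shows "even (card S)"
proof -
  let ?C = "(\<lambda>x. {x, f x}) ` S"
  have "2 * card ?C = card (\<Union>?C)"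
  proof (rule card_partition)
    show "finite ?C" "finite (\<Union>?C)" using fin by auto
    show "card c = 2" if "c \<in> ?C" for c
    proof -
      from that obtain x where "x \<in> S" "c = {x, f x}" by blast
      then show ?thesis using inv[of x] by (metis card_2_iff)
    qed
    show "c1 \<inter> c2 = {}" if "c1 \<in> ?C" "c2 \<in> ?C" "c1 \<noteq> c2" for c1 c2
    proof -
      from that obtain x y where xy: "x \<in> S" "y \<in> S" "c1 = {x, f x}" "c2 = {y, f y}" by blast
      then show ?thesis using that(3) inv[of x] inv[of y] by (metis doubleton_eq_iff disjoint_iff insertE singletonD)
    qed
  qed
  moreover have "\<Union>?C = S" using inv by auto
  ultimately show ?thesis by (metis dvd_triv_left)
qed

text \<open>Gives both the restriction on \<open>m\<close> and, through
  \<open>m - 1 \<le> D\<close>, the lower bound on the maximum degree.\<close>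

lemma good_graph_parameters:
  assumes good: "good_graph m D V E" and m: "m \<ge> 1"
  shows "D \<ge> 2 \<and> (m = 4 \<or> (m \<ge> 3 \<and> odd m \<and> m - 1 \<le> D))"
proof -
  note g = good_graphD(1)[OF good] and cardV = good_graphD(2)[OF good]
    and deg = good_graphD(3)[OF good] and lower = good_graphD(4)[OF good]
    and crit = good_graphD(5)[OF good]
  have finV: "finite V" and EV: "\<And>x y. E x y \<Longrightarrow> x \<in> V \<and> y \<in> V"
    and sym: "\<And>x y. E x y \<Longrightarrow> E y x" and irr: "\<And>x. \<not> E x x"
    using g unfolding graph_def by auto
  obtain v where v: "v \<in> V" "degree V E v = D" using good_graph_max_degree_vertex[OF good m] .
  define N where "N = {u. E v u}"
  have N: "N \<subseteq> V" "v \<notin> N" "card N = D" "finite N"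
    using EV irr v(2) degree_eq_card[OF g, of v] finV finite_subset[of N V] by (auto simp: N_def)
  have D: "D \<ge> 2" using deg[OF v(1)] v(2) by simp
  define S where "S = V - {v} - N"
  have finS: "finite S" and S: "S \<subseteq> V" using finV by (auto simp: S_def)
  have cardS: "card S = m - 1"
  proof -
    have "card S = card (V - {v}) - card N"
      unfolding S_def using N by (intro card_Diff_subset) auto
    then show ?thesis using v N cardV finV by simp
  qed
  have domS: "dominates E S (V - {v})"
  proof -
    obtain T where T: "T \<subseteq> V - {v}" "dominates E T (V - {v})" "card T < m" using crit[OF v(1)] by blast
    have finT: "finite T" using T(1) finV finite_subset by blast
    \<comment> \<open>A member of \<open>N\<close> in \<open>T\<close> would dominate
      \<open>v\<close> too, giving a total dominating set of fewer than \<open>m\<close>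
      vertices.\<close>
    have TN: "T \<inter> N = {}"
    proof (rule ccontr)
      assume "T \<inter> N \<noteq> {}"
      then obtain t where t: "t \<in> T" "E v t" by (auto simp: N_def)
      have "dominates E T V" unfolding dominates_def
      proof
        fix x assume "x \<in> V"
        then show "\<exists>t\<in>T. E x t" using T(2) t by (cases "x = v") (auto simp: dominates_def)
      qed
      then show False using lower[of T] T by auto
    qed
    \<comment> \<open>One neighbour of \<open>v\<close> completes \<open>T\<close> to a total
      dominating set, so \<open>T\<close> has at least \<open>m - 1 = card S\<close> elements; being
      inside \<open>S\<close>, it is all of \<open>S\<close>.\<close>
    obtain u where u: "u \<in> V" "E v u" using two_neighbours[of V E v] D v by auto
    have "dominates E (insert u T) V" unfolding dominates_def
    proof
      fix x assume "x \<in> V"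
      then show "\<exists>t\<in>insert u T. E x t" using T(2) u by (cases "x = v") (auto simp: dominates_def)
    qed
    moreover have "insert u T \<subseteq> V" using u T by auto
    ultimately have "m \<le> card (insert u T)" using lower by blast
    then have "m - 1 \<le> card T" using finT by (simp add: card_insert_if split: if_splits)
    moreover have "T \<subseteq> S" using T(1) TN by (auto simp: S_def)
    ultimately have "T = S" using card_seteq[OF finS] cardS by simp
    then show ?thesis using T by simp
  qed
  define f where "f x = (SOME y. y \<in> S \<and> E x y)" for x
  have f: "f x \<in> S \<and> E x (f x)" if "x \<in> V - {v}" for x
  proof -
    have "\<exists>y. y \<in> S \<and> E x y" using domS that unfolding dominates_def by blast
    then show ?thesis unfolding f_def by (rule someI_ex)
  qed
  \<comment> \<open>\<open>v\<close> and \<open>u\<close> take care of everything outside \<open>S - N(u)\<close>, so \<open>S - N(u)\<close> must be expensive.\<close>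
  have key: "m \<le> card T + 2" if u: "u \<in> N" and T: "T \<subseteq> V" "dominates E T {s \<in> S. \<not> E u s}" for u T
  proof -
    have finT: "finite T" using T(1) finV finite_subset by blast
    have vu: "E v u" "u \<in> V" using u N by (auto simp: N_def)
    have "dominates E (T \<union> {v, u}) V" unfolding dominates_def
    proof
      fix x assume x: "x \<in> V"
      consider "x = v" | "x \<in> N" | "x \<in> S" "E u x" | "x \<in> {s \<in> S. \<not> E u s}"
        using x by (auto simp: S_def)
      then show "\<exists>t\<in>T \<union> {v, u}. E x t"
      proof cases
        case 1 then show ?thesis using vu by blast
      next
        case 2 then have "E x v" using sym[of v x] by (simp add: N_def)
        then show ?thesis by blast
      next
        case 3 then have "E x u" using sym[of u x] by simp
        then show ?thesis by blast
      next
        case 4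
        then obtain t where "t \<in> T" "E x t" using T(2) unfolding dominates_def by blast
        then show ?thesis by blast
      qed
    qed
    then have "m \<le> card (T \<union> {v, u})" using lower[of "T \<union> {v, u}"] T(1) v vu by simp
    also have "\<dots> \<le> card T + card {v, u}" by (rule card_Un_le)
    also have "\<dots> \<le> card T + 2" by (simp add: card_insert_if)
    finally show ?thesis .
  qed
  \<comment> \<open>Without two neighbours of \<open>u\<close>, \<open>S\<close> has only
    \<open>m - 3\<close> elements, and one \<open>f\<close>-value for each of them stays below the
    bound \<open>m - 2\<close> from \<open>key\<close>.\<close>
  have unique: "x = y" if "u \<in> N" "x \<in> S" "y \<in> S" "E u x" "E u y" for u x y
  proof (rule ccontr)
    assume ne: "x \<noteq> y"
    have "dominates E (f ` (S - {x, y})) {s \<in> S. \<not> E u s}" unfolding dominates_def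
    proof
      fix s assume s: "s \<in> {s \<in> S. \<not> E u s}"
      then have "s \<in> S - {x, y}" "E s (f s)" using that f[of s] by (auto simp: S_def)
      then show "\<exists>t\<in>f ` (S - {x, y}). E s t" by blast
    qed
    moreover have "f ` (S - {x, y}) \<subseteq> V"
    proof
      fix z assume "z \<in> f ` (S - {x, y})"
      then obtain s where "s \<in> S" "z = f s" by blast
      then show "z \<in> V" using f[of s] S by (auto simp: S_def)
    qed
    ultimately have "m \<le> card (f ` (S - {x, y})) + 2" using key that(1) by blast
    moreover have "card (f ` (S - {x, y})) \<le> card (S - {x, y})" using finS by (intro card_image_le) auto
    moreover have "card (S - {x, y}) = card S - 2"
      using finS ne that by (subst card_Diff_subset) auto
    \<comment> \<open>Natural subtraction truncates; this inequality makes \<open>card S - 2\<close>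
      a genuine difference.\<close>
    moreover have "card S \<ge> card {x, y}" using finS that by (intro card_mono) auto
    ultimately show False using cardS ne by simp
  qed
  \<comment> \<open>\<open>z\<close> serves both \<open>p\<close> and \<open>q\<close>, and
    \<open>u\<close> serves \<open>x\<close>, so \<open>1 + (m - 4)\<close> vertices suffice for
    \<open>S - N(u)\<close>, again below \<open>m - 2\<close>.\<close>
  have no_common: False
    if "u \<in> N" "x \<in> S" "E u x" "p \<in> S" "q \<in> S" "p \<noteq> q" "p \<noteq> x" "q \<noteq> x" "E p z" "E q z" for u x p q z
  proof -
    let ?T = "insert z (f ` (S - {x, p, q}))"
    have "dominates E ?T {s \<in> S. \<not> E u s}" unfolding dominates_def
    proof
      fix s assume s: "s \<in> {s \<in> S. \<not> E u s}"
      then have "s \<in> S" "s \<noteq> x" "E s (f s)" using that f[of s] by (auto simp: S_def)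
      then show "\<exists>t\<in>?T. E s t" using that(9,10) by (cases "s = p \<or> s = q") auto
    qed
    moreover have "?T \<subseteq> V"
    proof
      fix y assume "y \<in> ?T"
      then consider "y = z" | s where "s \<in> S" "y = f s" by blast
      then show "y \<in> V"
      proof cases
        case 1 then show ?thesis using EV[OF that(9)] by simp
      next
        case 2 then show ?thesis using f[of s] S by (auto simp: S_def)
      qed
    qed
    ultimately have "m \<le> card ?T + 2" using key that(1) by blast
    moreover have "card ?T \<le> Suc (card (f ` (S - {x, p, q})))" by (simp add: card_insert_if finS)
    moreover have "card (f ` (S - {x, p, q})) \<le> card (S - {x, p, q})" using finS by (intro card_image_le) auto
    moreover have "card (S - {x, p, q}) = card S - 3"
      using finS that by (subst card_Diff_subset) auto
    moreover have "card S \<ge> card {x, p, q}" using finS that by (intro card_mono) auto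
    moreover have "card {x, p, q} = 3" using that by auto
    ultimately show False using cardS by simp
  qed
  define X where "X = {x \<in> S. \<exists>u\<in>N. E u x}"
  have "\<exists>u. u \<in> N" using D N(3) by (metis card.empty ex_in_conv not_numeral_le_zero)
  then obtain u0 where u0: "u0 \<in> N" ..
  define x0 where "x0 = f u0"
  have x0: "x0 \<in> X" using f[of u0] u0 N unfolding X_def x0_def by blast
  have "m = 4 \<or> (m \<ge> 3 \<and> odd m \<and> m - 1 \<le> D)"
  proof (cases "X = S")
    case True
    \<comment> \<open>\<open>w\<close> has a neighbour \<open>u\<close> in \<open>N\<close>. Two
      neighbours of \<open>w\<close> in \<open>S\<close> would be elements of \<open>S - {w}\<close>
      with the common neighbour \<open>w\<close>, against \<open>no_common\<close> with
      \<open>x = w\<close>.\<close>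
    have single: "a = b" if "w \<in> S" "a \<in> S" "b \<in> S" "E w a" "E w b" for w a b
    proof (rule ccontr)
      assume "a \<noteq> b"
      moreover have "a \<noteq> w" "b \<noteq> w" using irr[of w] that by auto
      moreover have "w \<in> X" using True that(1) by simp
      then obtain u where "u \<in> N" "E u w" by (auto simp: X_def)
      ultimately show False
        using no_common[of u w a b w] that sym[of w a] sym[of w b] by simp
    qed
    \<comment> \<open>By \<open>single\<close>, \<open>f\<close> sends each element of
      \<open>S\<close> to its only neighbour in \<open>S\<close>, hence is an involution.\<close>
    have "even (card S)"
    proof (rule even_card_perfect_matching[OF finS, of f])
      fix x assume "x \<in> S"
      then have 1: "f x \<in> S" "E x (f x)" using f[of x] by (auto simp: S_def)
      then have 2: "f (f x) \<in> S" "E (f x) (f (f x))" using f[of "f x"] by (auto simp: S_def)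
      have "f x \<noteq> x" using 1 irr[of x] by auto
      moreover have "f (f x) = x" using single[OF 1(1) 2(1) \<open>x \<in> S\<close> 2(2)] sym[OF 1(2)] by simp
      ultimately show "f x \<in> S \<and> f x \<noteq> x \<and> f (f x) = x" using 1 by simp
    qed
    moreover have "card S \<noteq> 0" using x0 finS unfolding X_def by auto
    moreover have "card S \<le> D"
    proof -
      \<comment> \<open>By \<open>unique\<close>, a vertex of \<open>N\<close> sees only one element
        of \<open>S\<close>, so distinct elements get distinct \<open>h\<close>-values.\<close>
      define h where "h x = (SOME u. u \<in> N \<and> E u x)" for x
      have h: "h x \<in> N \<and> E (h x) x" if "x \<in> S" for x
      proof -
        have "x \<in> X" using that True by simp
        then have "\<exists>u. u \<in> N \<and> E u x" by (auto simp: X_def)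
        then show ?thesis unfolding h_def by (rule someI_ex)
      qed
      have "inj_on h S"
      proof (rule inj_onI)
        fix x y assume "x \<in> S" "y \<in> S" "h x = h y"
        then show "x = y" using unique[of "h x" x y] h[of x] h[of y] by simp
      qed
      moreover have "h ` S \<subseteq> N" using h by blast
      ultimately show ?thesis using card_inj_on_le[of h S N] N by simp
    qed
    ultimately have "even (m - 1)" "m - 1 \<noteq> 0" "m - 1 \<le> D" using cardS by simp_all
    then show ?thesis by presburger
  next
    case False
    \<comment> \<open>All neighbours of \<open>w\<close> lie in \<open>S\<close>: \<open>v\<close>
      is excluded by \<open>w \<notin> N\<close>, and \<open>N\<close> by
      \<open>w \<notin> X\<close>. An \<open>x\<close> in \<open>X\<close> other than
      \<open>a\<close> and \<open>b\<close> would contradict \<open>no_common\<close>, as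
      \<open>a\<close> and \<open>b\<close> share the neighbour \<open>w\<close>.\<close>
    have pair: "\<exists>a b. a \<in> S \<and> b \<in> S \<and> a \<noteq> b \<and> E w a \<and> E w b \<and> X \<subseteq> {a, b}" if w: "w \<in> S" "w \<notin> X" for w
    proof -
      have nb: "y \<in> S" if "E w y" for y
      proof -
        have "y \<in> V" using EV that by blast
        moreover have "y \<noteq> v" using w that sym unfolding S_def N_def by blast
        moreover have "y \<notin> N" using w that sym unfolding X_def by blast
        ultimately show ?thesis by (simp add: S_def)
      qed
      have "w \<in> V" using w S by blast
      then obtain a b where ab: "a \<noteq> b" "E w a" "E w b" using two_neighbours[of V E w] deg[of w] by blast
      have "x = a \<or> x = b" if x: "x \<in> X" for x
      proof (rule ccontr)
        assume "\<not> (x = a \<or> x = b)"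
        then have "a \<noteq> x" "b \<noteq> x" by auto
        moreover obtain u where "u \<in> N" "E u x" "x \<in> S" using x unfolding X_def by blast
        ultimately show False using no_common[of u x a b w] nb ab sym[of w a] sym[of w b] by simp
      qed
      then show ?thesis using ab nb by blast
    qed
    obtain w where w: "w \<in> S" "w \<notin> X" using False unfolding X_def by blast
    obtain a b where ab: "a \<in> S" "b \<in> S" "a \<noteq> b" "E w a" "E w b" "X \<subseteq> {a, b}" using pair[OF w] by blast
    \<comment> \<open>A fourth element \<open>c\<close> would also lie outside \<open>X\<close> and
      hence, like \<open>w\<close>, be adjacent to \<open>x0\<close>; then \<open>c\<close> and
      \<open>w\<close> share the neighbour \<open>x0\<close>.\<close>
    have "c \<in> {w, a, b}" if c: "c \<in> S" for c
    proof (rule ccontr)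
      assume nc: "c \<notin> {w, a, b}"
      then have "c \<notin> X" using ab by blast
      then obtain a' b' where ab': "E c a'" "E c b'" "X \<subseteq> {a', b'}" using pair[OF c] by blast
      have "E c x0" "E w x0" using ab ab' x0 by blast+
      moreover obtain u where "u \<in> N" "E u x0" "x0 \<in> S" using x0 unfolding X_def by blast
      moreover have "c \<noteq> x0" "w \<noteq> x0" using calculation irr by auto
      ultimately show False using no_common[of u x0 c w x0] c w(1) nc by simp
    qed
    then have "S = {w, a, b}" using w ab by blast
    moreover have "w \<noteq> a" "w \<noteq> b" using ab irr by auto
    ultimately have "card S = 3" using ab by simp
    then have "m = 4" using cardS by linarith
    then show ?thesis by simp
  qed
  then show ?thesis using D by simp
qed

section \<open>Constructions\<close>

text \<open>The notation for both kinds of graphs built below: \<open>v\<close> is the vertex of degree \<open>|A| + |B|\<close>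
  with neighbourhood \<open>A \<union> B\<close>, and \<open>F\<close> is the graph induced there. The non-neighbours of \<open>v\<close> are
  an edge \<open>x y\<close> in \<open>graph3\<close> and a path \<open>x z y\<close> in \<open>graph4\<close>; in both \<open>x\<close> is joined to \<open>A\<close> and
  \<open>y\<close> to \<open>B\<close>. Then \<open>core3\<close> and \<open>core4\<close> are what remains of criticality as conditions on \<open>F\<close>.\<close>

definition bipartition :: "'a set \<Rightarrow> 'a set \<Rightarrow> ('a \<Rightarrow> 'a \<Rightarrow> bool) \<Rightarrow> bool" where
  "bipartition A B F \<longleftrightarrow> graph (A \<union> B) F \<and> A \<inter> B = {} \<and> A \<noteq> {} \<and> B \<noteq> {}"

text \<open>\<open>F\<close> may have edges inside \<open>A\<close> and inside \<open>B\<close>. The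
  first conjunct says that no \<open>{a, x}\<close> is a total dominating set of
  \<open>graph3\<close>. The second provides, after deletion of \<open>w\<close> from
  \<open>A\<close>, the total dominating set \<open>{b, y}\<close> or \<open>{a, b}\<close>.\<close>

definition half3 :: "'a set \<Rightarrow> 'a set \<Rightarrow> ('a \<Rightarrow> 'a \<Rightarrow> bool) \<Rightarrow> bool" where
  "half3 A B F \<longleftrightarrow> (\<forall>a\<in>A. \<not> dominates F {a} B) \<and>
     (\<forall>w\<in>A. (\<exists>b\<in>B. dominates F {b} (A - {w})) \<or>
        (\<exists>a\<in>A - {w}. \<exists>b\<in>B. dominates F {a, b} (A \<union> B - {w})))"

definition core3 :: "'a set \<Rightarrow> 'a set \<Rightarrow> ('a \<Rightarrow> 'a \<Rightarrow> bool) \<Rightarrow> bool" where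
  "core3 A B F \<longleftrightarrow> bipartition A B F \<and> half3 A B F \<and> half3 B A F \<and>
     (\<forall>a\<in>A. \<forall>b\<in>B. \<not> dominates F {a, b} (A \<union> B))"

text \<open>The first conjunct says that no \<open>{a, b, y}\<close> is a total dominating set of
  \<open>graph4\<close>. The second provides, after deletion of \<open>w\<close> from
  \<open>A\<close>, the total dominating set \<open>{b, y, z}\<close> or
  \<open>{a, b, y}\<close>.\<close>

definition half4 :: "'a set \<Rightarrow> 'a set \<Rightarrow> ('a \<Rightarrow> 'a \<Rightarrow> bool) \<Rightarrow> bool" where
  "half4 A B F \<longleftrightarrow> (\<forall>a\<in>A. \<forall>b\<in>B. \<not> dominates F {a, b} A) \<and>
     (\<forall>w\<in>A. (\<exists>b\<in>B. dominates F {b} (A - {w})) \<or>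
        (\<exists>a\<in>A - {w}. \<exists>b\<in>B. dominates F {a, b} (A - {w})))"

definition core4 :: "'a set \<Rightarrow> 'a set \<Rightarrow> ('a \<Rightarrow> 'a \<Rightarrow> bool) \<Rightarrow> bool" where
  "core4 A B F \<longleftrightarrow> bipartition A B F \<and> half4 A B F \<and> half4 B A F"

text \<open>The last conjunct makes gluing at \<open>v\<close> safe: a set using \<open>v\<close> saves nothing by leaving the
  domination of \<open>v\<close> itself to the graph attached there.\<close>

definition good_root :: "nat \<Rightarrow> nat \<Rightarrow> 'a set \<Rightarrow> ('a \<Rightarrow> 'a \<Rightarrow> bool) \<Rightarrow> 'a \<Rightarrow> bool" where
  "good_root m D V E v \<longleftrightarrow> good_graph m D V E \<and> v \<in> V \<and> degree V E v = D \<and>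
     (\<forall>T\<subseteq>V. v \<in> T \<and> dominates E T (V - {v}) \<longrightarrow> m \<le> card T)"

definition joined :: "'a \<Rightarrow> 'a set \<Rightarrow> 'a \<Rightarrow> 'a \<Rightarrow> bool" where
  "joined v N p q \<longleftrightarrow> p = v \<and> q \<in> N \<or> q = v \<and> p \<in> N"

definition graph3 :: "'a set \<Rightarrow> 'a set \<Rightarrow> ('a \<Rightarrow> 'a \<Rightarrow> bool) \<Rightarrow> 'a \<Rightarrow> 'a \<Rightarrow> 'a \<Rightarrow> 'a \<Rightarrow> 'a \<Rightarrow> bool" where
  "graph3 A B F v x y p q \<longleftrightarrow> F p q \<or> joined v (A \<union> B) p q \<or> joined x (insert y A) p q \<or> joined y B p q"

definition graph4 :: "'a set \<Rightarrow> 'a set \<Rightarrow> ('a \<Rightarrow> 'a \<Rightarrow> bool) \<Rightarrow> 'a \<Rightarrow> 'a \<Rightarrow> 'a \<Rightarrow> 'a \<Rightarrow> 'a \<Rightarrow> 'a \<Rightarrow> bool" where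
  "graph4 A B F v x z y p q \<longleftrightarrow>
     F p q \<or> joined v (A \<union> B) p q \<or> joined x (insert z A) p q \<or> joined y (insert z B) p q"

lemma bipartition_swap: "bipartition A B F \<longleftrightarrow> bipartition B A F"
  by (auto simp: bipartition_def Un_commute Int_commute)

lemma dominates_mono:
  "dominates F T X \<Longrightarrow> T \<subseteq> T' \<Longrightarrow> (\<And>p q. F p q \<Longrightarrow> E p q) \<Longrightarrow> Y \<subseteq> X \<Longrightarrow> dominates E T' Y"
  unfolding dominates_def by (meson subsetD)

lemma bipartitionD:
  assumes "bipartition A B F"
  shows "finite A" "finite B" "A \<inter> B = {}" "A \<noteq> {}" "B \<noteq> {}" "card (A \<union> B) = card A + card B"
    and "F p q \<Longrightarrow> p \<in> A \<union> B" "F p q \<Longrightarrow> q \<in> A \<union> B" "F p q \<Longrightarrow> F q p" "\<not> F p p"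
  using assms by (auto simp: bipartition_def graph_def card_Un_disjoint)

text \<open>\<open>a\<close> is adjacent neither to itself nor to some \<open>b\<close> in
  \<open>B\<close>. The two spare places make room for the two further neighbours of
  \<open>a\<close> in \<open>graph3\<close> and \<open>graph4\<close>, so its degree does not exceed
  that of \<open>v\<close>.\<close>

lemma card_nbrs_core:
  assumes bip: "bipartition A B F" and a: "a \<in> A" "\<not> dominates F {a} B"
  shows "card {q. F a q} + 2 \<le> card A + card B"
proof -
  note sets = bipartitionD(1-6)[OF bip]
  obtain b where b: "b \<in> B" "\<not> F b a" using a(2) by (auto simp: dominates_def)
  have "a \<noteq> b" using a b sets(3) by blast
  then have two: "card {a, b} = 2" by simp
  have "{q. F a q} \<subseteq> (A \<union> B) - {a, b}"
    using b bipartitionD(8-10)[OF bip] by blast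
  then have "card {q. F a q} \<le> card ((A \<union> B) - {a, b})" using sets by (intro card_mono) auto
  also have "\<dots> = card (A \<union> B) - card {a, b}" using sets a b by (intro card_Diff_subset) auto
  finally have "card {q. F a q} \<le> card A + card B - 2" using sets(6) two by simp
  moreover have "card A \<noteq> 0" "card B \<noteq> 0" using sets by auto
  ultimately show ?thesis by linarith
qed

text \<open>Because of this symmetry, the lemmas on degrees and on deletion treat only
  \<open>insert x A\<close>; the other side follows by exchange.\<close>

lemma graph3_swap: "graph3 B A F v y x = graph3 A B F v x y"
  by (rule ext)+ (auto simp: graph3_def joined_def)

lemma graph4_swap: "graph4 B A F v y z x = graph4 A B F v x z y"
  by (rule ext)+ (auto simp: graph4_def joined_def)

section \<open>The graphs with total domination number three\<close>

lemma degree_graph3: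
  assumes bip: "bipartition A B F" and fresh: "distinct [v, x, y]" "{v, x, y} \<inter> (A \<union> B) = {}"
    and g: "graph ({v, x, y} \<union> A \<union> B) (graph3 A B F v x y)"
    and nd: "\<And>a. a \<in> A \<Longrightarrow> \<not> dominates F {a} B"
    and u: "u \<in> insert x A"
  defines "d \<equiv> degree ({v, x, y} \<union> A \<union> B) (graph3 A B F v x y) u"
  shows "2 \<le> d \<and> d \<le> card A + card B"
proof -
  note sets = bipartitionD(1-6)[OF bip] and F = bipartitionD(7-10)[OF bip]
  have d: "d = card {q. graph3 A B F v x y u q}" unfolding d_def by (rule degree_eq_card[OF g])
  show ?thesis
  proof (cases "u = x")
    case True
    have "{q. graph3 A B F v x y x q} = insert y A"
      using fresh F by (auto simp: graph3_def joined_def)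
    then have "d = Suc (card A)" using d True sets fresh by simp
    moreover have "card A \<noteq> 0" "card B \<noteq> 0" using sets by auto
    ultimately show ?thesis by linarith
  next
    case False
    then have a: "u \<in> A" using u by simp
    have "{q. graph3 A B F v x y u q} = insert v (insert x {q. F u q})"
      using fresh F a sets by (auto simp: graph3_def joined_def)
    moreover have "finite {q. F u q}"
      by (rule finite_subset[of _ "A \<union> B"]) (use F sets in auto)
    moreover have "\<not> F u v" "\<not> F u x" "v \<noteq> x" using F fresh by auto
    ultimately have "d = card {q. F u q} + 2" using d by simp
    then show ?thesis using card_nbrs_core[OF bip a nd[OF a]] by simp
  qed
qed

text \<open>Deleting \<open>x\<close> leaves \<open>{v, b}\<close>: \<open>v\<close> covers both
  sides, and \<open>b\<close> covers \<open>v\<close> and \<open>y\<close>. For \<open>w\<close> in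
  \<open>A\<close>, \<open>half3\<close> supplies the set.\<close>

lemma critical_graph3:
  assumes bip: "bipartition A B F" and fresh: "distinct [v, x, y]" "{v, x, y} \<inter> (A \<union> B) = {}"
    and half: "half3 A B F" and w: "w \<in> insert x A"
  shows "\<exists>T \<subseteq> {v, x, y} \<union> A \<union> B - {w}.
    dominates (graph3 A B F v x y) T ({v, x, y} \<union> A \<union> B - {w}) \<and> card T < 3"
proof (cases "w = x")
  case True
  obtain b where "b \<in> B" using bipartitionD(5)[OF bip] by blast
  then show ?thesis
    using True fresh by (intro exI[of _ "{v, b}"]) (auto simp: dominates_def graph3_def joined_def card_insert_if)
next
  case False
  then have w: "w \<in> A" using w by simp
  then consider b where "b \<in> B" "dominates F {b} (A - {w})"
    | a b where "a \<in> A - {w}" "b \<in> B" "dominates F {a, b} (A \<union> B - {w})"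
    using half unfolding half3_def by blast
  then show ?thesis
  proof cases
    case 1
    then show ?thesis
      using w fresh bipartitionD(3)[OF bip]
      by (intro exI[of _ "{b, y}"]) (auto simp: dominates_def graph3_def joined_def card_insert_if)
  next
    case 2
    then show ?thesis
      using w fresh bipartitionD(3)[OF bip]
      by (intro exI[of _ "{a, b}"]) (auto simp: dominates_def graph3_def joined_def card_insert_if)
  qed
qed

text \<open>\<open>x\<close> and \<open>y\<close> need neighbours from the disjoint sets
  \<open>insert y A\<close> and \<open>insert x B\<close>, so a total dominating set of size two has
  one element in each. Dominating \<open>v\<close> leaves \<open>{a, b}\<close>,
  \<open>{a, x}\<close> and \<open>{y, b}\<close>, one for each non-domination condition in
  \<open>core3\<close>. A set containing \<open>v\<close> has a third element because
  \<open>v\<close> lies in neither neighbourhood.\<close>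

lemma good_root_graph3:
  assumes core: "core3 A B F" and fresh: "distinct [v, x, y]" "{v, x, y} \<inter> (A \<union> B) = {}"
  shows "good_root 3 (card A + card B) ({v, x, y} \<union> A \<union> B) (graph3 A B F v x y) v"
proof -
  let ?V = "{v, x, y} \<union> A \<union> B" and ?E = "graph3 A B F v x y"
  have bip: "bipartition A B F" and half: "half3 A B F" "half3 B A F"
    and pair: "\<And>a b. a \<in> A \<Longrightarrow> b \<in> B \<Longrightarrow> \<not> dominates F {a, b} (A \<union> B)"
    using core unfolding core3_def by auto
  have bip': "bipartition B A F" using bip bipartition_swap by blast
  note sets = bipartitionD(1-6)[OF bip] and F = bipartitionD(7-10)[OF bip]
  have g: "graph ?V ?E" using sets F fresh by (auto simp: graph_def graph3_def joined_def)
  have nbx: "{t. ?E x t} = insert y A" and nby: "{t. ?E y t} = insert x B" and nbv: "{t. ?E v t} = A \<union> B"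
    using fresh F by (auto simp: graph3_def joined_def)
  have fresh': "distinct [v, y, x]" "{v, y, x} \<inter> (B \<union> A) = {}" using fresh by auto
  have swap: "{v, y, x} \<union> B \<union> A = ?V" by auto
  have swapE: "graph3 B A F v y x = ?E" by (rule graph3_swap)
  have g': "graph ({v, y, x} \<union> B \<union> A) (graph3 B A F v y x)" unfolding swap swapE by (rule g)
  have degv: "degree ?V ?E v = card A + card B" using degree_eq_card[OF g] nbv sets by simp
  have xy: "\<exists>s\<in>T. \<exists>t\<in>T. s \<in> insert y A \<and> t \<in> insert x B" if "dominates ?E T (?V - {v})" for T
  proof -
    have "\<exists>s\<in>T. ?E x s" "\<exists>t\<in>T. ?E y t" using that fresh unfolding dominates_def by auto
    then show ?thesis using nbx nby by blast
  qed
  have ne: "s \<noteq> t" if "s \<in> insert y A" "t \<in> insert x B" for s t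
    using that fresh sets by auto
  have finV: "finite ?V" using sets by simp
  have "good_graph 3 (card A + card B) ?V ?E"
  proof (rule good_graphI[OF g _ degv])
    show "v \<in> ?V" by simp
    show "card ?V = card A + card B + 3"
    proof -
      have "card ({v, x, y} \<union> (A \<union> B)) = card {v, x, y} + card (A \<union> B)"
        using sets fresh by (intro card_Un_disjoint) auto
      then show ?thesis using sets fresh by (simp add: Un_assoc)
    qed
    show "2 \<le> degree ?V ?E u \<and> degree ?V ?E u \<le> card A + card B" if u: "u \<in> ?V" for u
    proof -
      consider "u = v" | "u \<in> insert x A" | "u \<in> insert y B" using u by auto
      then show ?thesis
      proof cases
        case 1
        have "card A \<noteq> 0" "card B \<noteq> 0" using sets by auto
        then show ?thesis using 1 degv by simp
      next
        case 2
        have "\<not> dominates F {a} B" if "a \<in> A" for a using half(1) that by (simp add: half3_def)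
        from degree_graph3[OF bip fresh g this 2] show ?thesis .
      next
        case 3
        have "\<not> dominates F {b} A" if "b \<in> B" for b using half(2) that by (simp add: half3_def)
        from degree_graph3[OF bip' fresh' g' this 3] show ?thesis
          unfolding swap swapE add.commute[of "card B" "card A"] .
      qed
    qed
    show "\<exists>T \<subseteq> ?V - {w}. dominates ?E T (?V - {w}) \<and> card T < 3" if w: "w \<in> ?V" for w
    proof -
      consider "w = v" | "w \<in> insert x A" | "w \<in> insert y B" using w by auto
      then show ?thesis
      proof cases
        case 1
        then show ?thesis
          using fresh
          by (intro exI[of _ "{x, y}"]) (auto simp: dominates_def graph3_def joined_def card_insert_if)
      next
        case 2 then show ?thesis by (rule critical_graph3[OF bip fresh half(1)])
      next
        case 3
        from critical_graph3[OF bip' fresh' half(2) this] show ?thesis unfolding swap swapE .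
      qed
    qed
    show "3 \<le> card T" if T: "T \<subseteq> ?V" "dominates ?E T ?V" for T
    proof (rule ccontr)
      assume less: "\<not> 3 \<le> card T"
      have finT: "finite T" using T finV finite_subset by blast
      have "dominates ?E T (?V - {v})" using T(2) unfolding dominates_def by blast
      from xy[OF this] obtain s t where st: "s \<in> T" "t \<in> T" "s \<in> insert y A" "t \<in> insert x B" by blast
      have "{s, t} \<subseteq> T" "card {s, t} = 2" using st ne by auto
      then have Teq: "T = {s, t}" using card_seteq[OF finT, of "{s, t}"] less by simp
      have "v \<in> ?V" by simp
      then obtain r where "r \<in> T" "?E v r" using T(2) unfolding dominates_def by blast
      then have "s \<in> A \<or> t \<in> B" using nbv Teq st fresh by auto
      have dom: "?E u s \<or> ?E u t" if "u \<in> A \<union> B" for u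
        using that T(2) Teq unfolding dominates_def by blast
      have FE: "?E u r \<longleftrightarrow> F u r" if "u \<in> A \<union> B" "r \<in> A \<union> B" for u r
        using that fresh by (auto simp: graph3_def joined_def)
      have nF: "\<not> F u x" "\<not> F u y" for u using F(2)[of u x] F(2)[of u y] fresh by auto
      have notx: "\<not> ?E u x" if "u \<in> B" for u
        using that fresh sets(3) nF by (auto simp: graph3_def joined_def)
      have noty: "\<not> ?E u y" if "u \<in> A" for u
        using that fresh sets(3) nF by (auto simp: graph3_def joined_def)
      consider "s \<in> A" "t \<in> B" | "s \<in> A" "t = x" | "s = y" "t \<in> B"
        using st \<open>s \<in> A \<or> t \<in> B\<close> by blast
      then show False
      proof cases
        case 1
        then have "F u s \<or> F u t" if "u \<in> A \<union> B" for u
          using dom[OF that] FE[OF that, of s] FE[OF that, of t] by blast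
        then have "dominates F {s, t} (A \<union> B)" by (simp add: dominates_def)
        then show False using pair[of s t] 1 by simp
      next
        case 2
        then have "F u s" if "u \<in> B" for u
          using dom[of u] FE[of u s] notx[of u] that by blast
        then have "dominates F {s} B" by (simp add: dominates_def)
        then show False using half(1) 2 unfolding half3_def by blast
      next
        case 3
        then have "F u t" if "u \<in> A" for u
          using dom[of u] FE[of u t] noty[of u] that by blast
        then have "dominates F {t} A" by (simp add: dominates_def)
        then show False using half(2) 3 unfolding half3_def by blast
      qed
    qed
  qed
  moreover have "3 \<le> card T" if T: "T \<subseteq> ?V" "v \<in> T \<and> dominates ?E T (?V - {v})" for T
  proof -
    have finT: "finite T" using T finV finite_subset by blast
    obtain s t where st: "s \<in> T" "t \<in> T" "s \<in> insert y A" "t \<in> insert x B" using xy T(2) by blast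
    have "v \<noteq> s" "v \<noteq> t" using st fresh by auto
    then have "card {v, s, t} = 3" using ne[OF st(3,4)] by simp
    moreover have "{v, s, t} \<subseteq> T" using st T by simp
    ultimately show ?thesis using card_mono[OF finT, of "{v, s, t}"] by simp
  qed
  ultimately show ?thesis
    unfolding good_root_def by (intro conjI allI impI degv) auto
qed


section \<open>The graphs with total domination number four\<close>

lemma critical_graph4:
  assumes bip: "bipartition A B F" and fresh: "distinct [v, x, z, y]" "{v, x, z, y} \<inter> (A \<union> B) = {}"
    and half: "half4 A B F" and w: "w \<in> insert x A"
  shows "\<exists>T \<subseteq> {v, x, z, y} \<union> A \<union> B - {w}.
    dominates (graph4 A B F v x z y) T ({v, x, z, y} \<union> A \<union> B - {w}) \<and> card T < 4"
proof (cases "w = x")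
  case True
  obtain b where "b \<in> B" using bipartitionD(5)[OF bip] by blast
  then show ?thesis
    using True fresh
    by (intro exI[of _ "{v, b, y}"]) (auto simp: dominates_def graph4_def joined_def card_insert_if)
next
  case False
  then have w: "w \<in> A" using w by simp
  then consider b where "b \<in> B" "dominates F {b} (A - {w})"
    | a b where "a \<in> A - {w}" "b \<in> B" "dominates F {a, b} (A - {w})"
    using half unfolding half4_def by blast
  then show ?thesis
  proof cases
    case 1
    then show ?thesis
      using w fresh bipartitionD(3)[OF bip]
      by (intro exI[of _ "{b, y, z}"]) (auto simp: dominates_def graph4_def joined_def card_insert_if)
  next
    case 2
    then show ?thesis
      using w fresh bipartitionD(3)[OF bip]
      by (intro exI[of _ "{a, b, y}"]) (auto simp: dominates_def graph4_def joined_def card_insert_if)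
  qed
qed

lemma degree_graph4:
  assumes bip: "bipartition A B F" and fresh: "distinct [v, x, z, y]" "{v, x, z, y} \<inter> (A \<union> B) = {}"
    and g: "graph ({v, x, z, y} \<union> A \<union> B) (graph4 A B F v x z y)"
    and nd: "\<And>a. a \<in> A \<Longrightarrow> \<not> dominates F {a} B"
    and u: "u \<in> insert x A"
  defines "d \<equiv> degree ({v, x, z, y} \<union> A \<union> B) (graph4 A B F v x z y) u"
  shows "2 \<le> d \<and> d \<le> card A + card B"
proof -
  note sets = bipartitionD(1-6)[OF bip] and F = bipartitionD(7-10)[OF bip]
  have d: "d = card {q. graph4 A B F v x z y u q}" unfolding d_def by (rule degree_eq_card[OF g])
  show ?thesis
  proof (cases "u = x")
    case True
    have "{q. graph4 A B F v x z y x q} = insert z A"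
      using fresh F by (auto simp: graph4_def joined_def)
    then have "d = Suc (card A)" using d True sets fresh by simp
    moreover have "card A \<noteq> 0" "card B \<noteq> 0" using sets by auto
    ultimately show ?thesis by linarith
  next
    case False
    then have a: "u \<in> A" using u by simp
    have "{q. graph4 A B F v x z y u q} = insert v (insert x {q. F u q})"
      using fresh F a sets by (auto simp: graph4_def joined_def)
    moreover have "finite {q. F u q}"
      by (rule finite_subset[of _ "A \<union> B"]) (use F sets in auto)
    moreover have "\<not> F u v" "\<not> F u x" "v \<noteq> x" using F fresh by auto
    ultimately have "d = card {q. F u q} + 2" using d by simp
    then show ?thesis using card_nbrs_core[OF bip a nd[OF a]] by simp
  qed
qed

text \<open>Domination of \<open>z\<close> forces \<open>x\<close> or \<open>y\<close> into
  \<open>T\<close>; this is the case of \<open>x\<close>, and exchanging the sides gives the other.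
  With only three vertices in \<open>T\<close>, the side \<open>B\<close> is left to at most one
  vertex from each side, which \<open>half4\<close> forbids.\<close>

lemma card_dominating_graph4:
  assumes bip: "bipartition A B F" and fresh: "distinct [v, x, z, y]" "{v, x, z, y} \<inter> (A \<union> B) = {}"
    and half: "half4 B A F"
    and T: "finite T" "dominates (graph4 A B F v x z y) T ({v, x, z, y} \<union> A \<union> B)" and "x \<in> T"
  shows "4 \<le> card T"
proof (rule ccontr)
  assume less: "\<not> 4 \<le> card T"
  note sets = bipartitionD(1-6)[OF bip] and F = bipartitionD(7-10)[OF bip]
  let ?E = "graph4 A B F v x z y"
  have nbx: "{t. ?E x t} = insert z A" and nby: "{t. ?E y t} = insert z B" and nbv: "{t. ?E v t} = A \<union> B"
    using fresh F by (auto simp: graph4_def joined_def)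
  have "\<exists>s\<in>T. ?E x s" "\<exists>t\<in>T. ?E y t" "\<exists>r\<in>T. ?E v r"
    using T(2) by (simp_all add: dominates_def)
  then obtain s t r where str: "s \<in> T" "t \<in> T" "r \<in> T" "s \<in> insert z A" "t \<in> insert z B" "r \<in> A \<union> B"
    using nbx nby nbv by blast
  have three: "T = {x, p, q}" if "p \<in> T" "q \<in> T" "p \<noteq> q" "p \<noteq> x" "q \<noteq> x" for p q
  proof -
    have "card {x, p, q} = 3" using that by simp
    moreover have "{x, p, q} \<subseteq> T" using that \<open>x \<in> T\<close> by simp
    ultimately show ?thesis using card_seteq[OF T(1), of "{x, p, q}"] less by simp
  qed
  \<comment> \<open>The vertices \<open>s\<close>, \<open>t\<close>, \<open>r\<close> may coincide,
    but in each case two of them differ and fill up \<open>T\<close>. \<open>a0\<close> and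
    \<open>b0\<close> pad the set when \<open>T\<close> misses a side.\<close>
  have "\<exists>a\<in>A. \<exists>b\<in>B. T \<subseteq> {x, z, a, b}"
  proof -
    obtain a0 b0 where a0: "a0 \<in> A" "b0 \<in> B" using sets by blast
    consider "s \<in> A" "t \<in> B" | "s \<in> A" "t = z" | "s = z" "r \<in> A" | "s = z" "r \<in> B"
      using str by blast
    then show ?thesis
    proof cases
      case 1
      then have "s \<noteq> t" "s \<noteq> x" "t \<noteq> x" using fresh sets(3) by auto
      from three[OF str(1,2) this] show ?thesis using 1 by blast
    next
      case 2
      then have "s \<noteq> t" "s \<noteq> x" "t \<noteq> x" using fresh by auto
      from three[OF str(1,2) this] show ?thesis using 2 a0 by blast
    next
      case 3
      then have "s \<noteq> r" "s \<noteq> x" "r \<noteq> x" using fresh by auto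
      from three[OF str(1,3) this] show ?thesis using 3 a0 by blast
    next
      case 4
      then have "s \<noteq> r" "s \<noteq> x" "r \<noteq> x" using fresh by auto
      from three[OF str(1,3) this] show ?thesis using 4 a0 by blast
    qed
  qed
  then obtain a b where ab: "a \<in> A" "b \<in> B" "T \<subseteq> {x, z, a, b}" by blast
  have "F u a \<or> F u b" if u: "u \<in> B" for u
  proof -
    obtain t where t: "t \<in> T" "?E u t" using T(2) u unfolding dominates_def by blast
    have "\<not> F u x" "\<not> F u z" using F(2)[of u x] F(2)[of u z] fresh by auto
    then have "\<not> ?E u x" "\<not> ?E u z" using u fresh sets(3) by (auto simp: graph4_def joined_def)
    then have "?E u a \<or> ?E u b" using t ab(3) by blast
    then show ?thesis using u ab(1,2) fresh by (auto simp: graph4_def joined_def)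
  qed
  then have "dominates F {b, a} B" by (auto simp: dominates_def)
  then show False using half ab unfolding half4_def by blast
qed

text \<open>Only \<open>good_graph\<close> is claimed: \<open>{v, x, z}\<close> dominates everything
  except \<open>v\<close>, so \<open>v\<close> is not a \<open>good_root\<close> and the gluing of
  5-cycles cannot start here.\<close>

lemma good_graph_graph4:
  assumes core: "core4 A B F" and fresh: "distinct [v, x, z, y]" "{v, x, z, y} \<inter> (A \<union> B) = {}"
  shows "good_graph 4 (card A + card B) ({v, x, z, y} \<union> A \<union> B) (graph4 A B F v x z y)"
proof -
  let ?V = "{v, x, z, y} \<union> A \<union> B" and ?E = "graph4 A B F v x z y"
  have bip: "bipartition A B F" and half: "half4 A B F" "half4 B A F"
    using core unfolding core4_def by auto
  have bip': "bipartition B A F" using bip bipartition_swap by blast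
  note sets = bipartitionD(1-6)[OF bip] and F = bipartitionD(7-10)[OF bip]
  have g: "graph ?V ?E" using sets F fresh by (auto simp: graph_def graph4_def joined_def)
  have nbz: "{t. ?E z t} = {x, y}" and nbv: "{t. ?E v t} = A \<union> B"
    using fresh F by (auto simp: graph4_def joined_def)
  have fresh': "distinct [v, y, z, x]" "{v, y, z, x} \<inter> (B \<union> A) = {}" using fresh by auto
  have swap: "{v, y, z, x} \<union> B \<union> A = ?V" by auto
  have swapE: "graph4 B A F v y z x = ?E" by (rule graph4_swap)
  have g': "graph ({v, y, z, x} \<union> B \<union> A) (graph4 B A F v y z x)" unfolding swap swapE by (rule g)
  have degv: "degree ?V ?E v = card A + card B" using degree_eq_card[OF g] nbv sets by simp
  have degz: "degree ?V ?E z = 2" using degree_eq_card[OF g] nbz fresh by simp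
  have "card A \<noteq> 0" "card B \<noteq> 0" using sets by auto
  then have two: "2 \<le> card A + card B" by linarith
  obtain a0 b0 where ab0: "a0 \<in> A" "b0 \<in> B" using sets by blast
  show ?thesis
  proof (rule good_graphI[OF g _ degv])
    show "v \<in> ?V" by simp
    show "card ?V = card A + card B + 4"
    proof -
      have "card ({v, x, z, y} \<union> (A \<union> B)) = card {v, x, z, y} + card (A \<union> B)"
        using sets fresh by (intro card_Un_disjoint) auto
      then show ?thesis using sets fresh by (simp add: Un_assoc)
    qed
    show "2 \<le> degree ?V ?E u \<and> degree ?V ?E u \<le> card A + card B" if u: "u \<in> ?V" for u
    proof -
      consider "u = v" | "u = z" | "u \<in> insert x A" | "u \<in> insert y B" using u by auto
      then show ?thesis
      proof cases
        case 1 then show ?thesis using two degv by simp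
      next
        case 2 then show ?thesis using two degz by simp
      next
        case 3
        \<comment> \<open>\<open>half4\<close> for the other side excludes every pair
          \<open>{b, a}\<close>, hence also \<open>{a}\<close>.\<close>
        have "\<not> dominates F {a} B" if "a \<in> A" for a
          using half(2) that ab0 by (force simp: half4_def dominates_def)
        from degree_graph4[OF bip fresh g this 3] show ?thesis .
      next
        case 4
        have "\<not> dominates F {b} A" if "b \<in> B" for b
          using half(1) that ab0 by (force simp: half4_def dominates_def)
        from degree_graph4[OF bip' fresh' g' this 4] show ?thesis
          unfolding swap swapE add.commute[of "card B" "card A"] .
      qed
    qed
    show "\<exists>T \<subseteq> ?V - {w}. dominates ?E T (?V - {w}) \<and> card T < 4" if w: "w \<in> ?V" for w
    proof -
      consider "w = v" | "w = z" | "w \<in> insert x A" | "w \<in> insert y B" using w by auto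
      then show ?thesis
      proof cases
        case 1
        then show ?thesis
          using fresh
          by (intro exI[of _ "{x, z, y}"]) (auto simp: dominates_def graph4_def joined_def card_insert_if)
      next
        case 2
        then show ?thesis
          using fresh ab0
          by (intro exI[of _ "{v, a0, b0}"]) (auto simp: dominates_def graph4_def joined_def card_insert_if)
      next
        case 3 then show ?thesis by (rule critical_graph4[OF bip fresh half(1)])
      next
        case 4
        from critical_graph4[OF bip' fresh' half(2) this] show ?thesis unfolding swap swapE .
      qed
    qed
    show "4 \<le> card T" if T: "T \<subseteq> ?V" "dominates ?E T ?V" for T
    proof -
      have finT: "finite T" using T(1) sets finite_subset[of T ?V] by simp
      have "\<exists>t\<in>T. ?E z t" using T(2) by (simp add: dominates_def)
      then obtain t where "t \<in> T" "t \<in> {t. ?E z t}" by blast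
      then have "x \<in> T \<or> y \<in> T" unfolding nbz by blast
      then show ?thesis
      proof
        assume "x \<in> T"
        then show ?thesis by (rule card_dominating_graph4[OF bip fresh half(2) finT T(2)])
      next
        assume "y \<in> T"
        moreover have "dominates (graph4 B A F v y z x) T ({v, y, z, x} \<union> B \<union> A)"
          unfolding swap swapE by (rule T(2))
        ultimately show ?thesis by (intro card_dominating_graph4[OF bip' fresh' half(1) finT])
      qed
    qed
  qed
qed

section \<open>Adding one vertex to each side\<close>

definition extend :: "'a set \<Rightarrow> 'a set \<Rightarrow> ('a \<Rightarrow> 'a \<Rightarrow> bool) \<Rightarrow> 'a \<Rightarrow> 'a \<Rightarrow> 'a \<Rightarrow> 'a \<Rightarrow> bool" where
  "extend A B F p q s t \<longleftrightarrow> F s t \<or> joined p B s t \<or> joined q A s t"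

lemma extend_swap: "extend B A F q p = extend A B F p q"
  by (rule ext)+ (auto simp: extend_def)

lemma bipartition_extend:
  assumes bip: "bipartition A B F" and fresh: "p \<noteq> q" "{p, q} \<inter> (A \<union> B) = {}"
  shows "bipartition (insert p A) (insert q B) (extend A B F p q)"
  using bipartitionD[OF bip] fresh
  by (auto simp: bipartition_def graph_def extend_def joined_def)

lemma extend_simps:
  assumes bip: "bipartition A B F" and fresh: "p \<noteq> q" "{p, q} \<inter> (A \<union> B) = {}"
  shows "u \<in> A \<union> B \<Longrightarrow> t \<in> A \<union> B \<Longrightarrow> extend A B F p q u t \<longleftrightarrow> F u t"
    and "extend A B F p q p t \<longleftrightarrow> t \<in> B" "extend A B F p q q t \<longleftrightarrow> t \<in> A"
    and "extend A B F p q t p \<longleftrightarrow> t \<in> B" "extend A B F p q t q \<longleftrightarrow> t \<in> A"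
  using bipartitionD(7,8)[OF bip] fresh by (auto simp: extend_def joined_def)

text \<open>\<open>p\<close> and \<open>q\<close> are not adjacent, so \<open>p\<close> fails to
  dominate \<open>q\<close>, while \<open>q\<close> alone dominates \<open>A\<close>, which settles
  the deletion of \<open>p\<close>. Old witnesses keep working, as \<open>b\<close> covers
  \<open>p\<close> and \<open>a\<close> covers \<open>q\<close>.\<close>

lemma half3_extend:
  assumes bip: "bipartition A B F" and fresh: "p \<noteq> q" "{p, q} \<inter> (A \<union> B) = {}"
    and half: "half3 A B F"
  shows "half3 (insert p A) (insert q B) (extend A B F p q)"
proof -
  note ext = extend_simps[OF bip fresh]
  note sets = bipartitionD(3)[OF bip]
  have "\<not> dominates (extend A B F p q) {a} (insert q B)" if a: "a \<in> insert p A" for a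
  proof (cases "a = p")
    case True
    then show ?thesis using ext fresh by (auto simp: dominates_def)
  next
    case False
    then have a: "a \<in> A" using a by simp
    then obtain b where b: "b \<in> B" "\<not> F b a" using half by (auto simp: half3_def dominates_def)
    then have "\<not> extend A B F p q b a" using ext(1)[of b a] a by simp
    then show ?thesis using b by (auto simp: dominates_def)
  qed
  moreover have "(\<exists>b\<in>insert q B. dominates (extend A B F p q) {b} (insert p A - {w})) \<or>
      (\<exists>a\<in>insert p A - {w}. \<exists>b\<in>insert q B.
         dominates (extend A B F p q) {a, b} (insert p A \<union> insert q B - {w}))"
    if w: "w \<in> insert p A" for w
  proof (cases "w = p")
    case True
    then show ?thesis using ext fresh by (intro disjI1 bexI[of _ q]) (auto simp: dominates_def)
  next
    case False
    then have w: "w \<in> A" using w by simp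
    then consider b where "b \<in> B" "dominates F {b} (A - {w})"
      | a b where "a \<in> A - {w}" "b \<in> B" "dominates F {a, b} (A \<union> B - {w})"
      using half unfolding half3_def by blast
    then show ?thesis
    proof cases
      case 1
      have "dominates (extend A B F p q) {b} (insert p A - {w})"
        using 1 ext by (auto simp: dominates_def)
      then show ?thesis using 1 by blast
    next
      case 2
      have "dominates (extend A B F p q) {a, b} (insert p A \<union> insert q B - {w})"
        using 2 ext by (auto simp: dominates_def)
      then show ?thesis using 2 by blast
    qed
  qed
  ultimately show ?thesis unfolding half3_def by blast
qed

lemma core3_extend:
  assumes core: "core3 A B F" and fresh: "p \<noteq> q" "{p, q} \<inter> (A \<union> B) = {}"
  shows "core3 (insert p A) (insert q B) (extend A B F p q)"
proof -
  have bip: "bipartition A B F" and half: "half3 A B F" "half3 B A F"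
    and pair: "\<And>a b. a \<in> A \<Longrightarrow> b \<in> B \<Longrightarrow> \<not> dominates F {a, b} (A \<union> B)"
    using core unfolding core3_def by auto
  have bip': "bipartition B A F" using bip bipartition_swap by blast
  have fresh': "q \<noteq> p" "{q, p} \<inter> (B \<union> A) = {}" using fresh by auto
  note ext = extend_simps[OF bip fresh]
  have "\<not> dominates (extend A B F p q) {a, b} (insert p A \<union> insert q B)"
    if ab: "a \<in> insert p A" "b \<in> insert q B" for a b
  proof
    assume dom: "dominates (extend A B F p q) {a, b} (insert p A \<union> insert q B)"
    then have "extend A B F p q p a \<or> extend A B F p q p b" "extend A B F p q q a \<or> extend A B F p q q b"
      by (simp_all add: dominates_def)
    \<comment> \<open>Only \<open>B\<close> sees \<open>p\<close> and only \<open>A\<close> sees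
      \<open>q\<close>, so both members of the pair are old and the claim reduces to
      \<open>F\<close>.\<close>
    then have "a \<in> A" "b \<in> B" using ab ext bipartitionD(3)[OF bip] fresh by auto
    moreover have "F u a \<or> F u b" if "u \<in> A \<union> B" for u
    proof -
      have "extend A B F p q u a \<or> extend A B F p q u b" using dom that by (auto simp: dominates_def)
      then show ?thesis using ext(1)[of u a] ext(1)[of u b] that \<open>a \<in> A\<close> \<open>b \<in> B\<close> by simp
    qed
    then have "dominates F {a, b} (A \<union> B)" by (auto simp: dominates_def)
    ultimately show False using pair[of a b] by simp
  qed
  moreover have "half3 (insert q B) (insert p A) (extend A B F p q)"
    using half3_extend[OF bip' fresh' half(2)] unfolding extend_swap[of B A F q p] .
  ultimately show ?thesis
    unfolding core3_def using bipartition_extend[OF bip fresh] half3_extend[OF bip fresh half(1)] by blast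
qed

lemma half4_extend:
  assumes bip: "bipartition A B F" and fresh: "p \<noteq> q" "{p, q} \<inter> (A \<union> B) = {}"
    and half: "half4 A B F"
  shows "half4 (insert p A) (insert q B) (extend A B F p q)"
proof -
  note ext = extend_simps[OF bip fresh]
  have sets: "A \<inter> B = {}" "A \<noteq> {}" "B \<noteq> {}" using bipartitionD(3-5)[OF bip] by auto
  have "\<not> dominates (extend A B F p q) {a, b} (insert p A)"
    if ab: "a \<in> insert p A" "b \<in> insert q B" for a b
  proof
    assume dom: "dominates (extend A B F p q) {a, b} (insert p A)"
    then have "extend A B F p q p a \<or> extend A B F p q p b" by (simp add: dominates_def)
    then have b: "b \<in> B" using ab ext sets fresh by auto
    have d: "extend A B F p q u a \<or> extend A B F p q u b" if "u \<in> A" for u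
      using dom that by (auto simp: dominates_def)
    \<comment> \<open>If \<open>a = p\<close>, it has no neighbour in \<open>A\<close>, so any old
      \<open>a0\<close> can replace it.\<close>
    obtain a0 where a0: "a0 \<in> A" "a = p \<or> a0 = a" using ab sets by blast
    have "F u a0 \<or> F u b" if u: "u \<in> A" for u
    proof -
      have "\<not> extend A B F p q u p" using ext(4)[of u] u sets(1) by blast
      then show ?thesis
        using d[OF u] ext(1)[of u a0] ext(1)[of u b] u a0 b by auto
    qed
    then have "dominates F {a0, b} A" by (auto simp: dominates_def)
    then show False using half a0 b unfolding half4_def by blast
  qed
  moreover have "(\<exists>b\<in>insert q B. dominates (extend A B F p q) {b} (insert p A - {w})) \<or>
      (\<exists>a\<in>insert p A - {w}. \<exists>b\<in>insert q B. dominates (extend A B F p q) {a, b} (insert p A - {w}))"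
    if w: "w \<in> insert p A" for w
  proof (cases "w = p")
    case True
    then show ?thesis using ext fresh by (intro disjI1 bexI[of _ q]) (auto simp: dominates_def)
  next
    case False
    then have w: "w \<in> A" using w by simp
    then consider b where "b \<in> B" "dominates F {b} (A - {w})"
      | a b where "a \<in> A - {w}" "b \<in> B" "dominates F {a, b} (A - {w})"
      using half unfolding half4_def by blast
    then show ?thesis
    proof cases
      case 1
      have "dominates (extend A B F p q) {b} (insert p A - {w})"
        using 1 ext by (auto simp: dominates_def)
      then show ?thesis using 1 by blast
    next
      case 2
      have "dominates (extend A B F p q) {a, b} (insert p A - {w})"
        using 2 ext by (auto simp: dominates_def)
      then show ?thesis using 2 by blast
    qed
  qed
  ultimately show ?thesis unfolding half4_def by blast
qed

lemma core4_extend: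
  assumes core: "core4 A B F" and fresh: "p \<noteq> q" "{p, q} \<inter> (A \<union> B) = {}"
  shows "core4 (insert p A) (insert q B) (extend A B F p q)"
proof -
  have bip: "bipartition A B F" and half: "half4 A B F" "half4 B A F"
    using core unfolding core4_def by auto
  have bip': "bipartition B A F" using bip bipartition_swap by blast
  have fresh': "q \<noteq> p" "{q, p} \<inter> (B \<union> A) = {}" using fresh by auto
  have "half4 (insert q B) (insert p A) (extend A B F p q)"
    using half4_extend[OF bip' fresh' half(2)] unfolding extend_swap[of B A F q p] .
  then show ?thesis
    unfolding core4_def using bipartition_extend[OF bip fresh] half4_extend[OF bip fresh half(1)] by blast
qed

section \<open>Solutions of the core conditions for each degree\<close>

lemma fresh_nats:
  assumes "finite (V :: nat set)"
  shows "\<exists>n. \<forall>k\<ge>n. k \<notin> V"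
proof -
  obtain n where "\<And>k. k \<in> V \<Longrightarrow> k < n" using assms unfolding finite_nat_set_iff_bounded by blast
  then show ?thesis by (intro exI[of _ n]) force
qed

text \<open>\<open>P\<close> stands for \<open>core3\<close> or \<open>core4\<close>. A step keeps
  the parity of \<open>card A + card B\<close>, so each parity needs its own start.\<close>

lemma core_extend_iterate:
  fixes P :: "nat set \<Rightarrow> nat set \<Rightarrow> (nat \<Rightarrow> nat \<Rightarrow> bool) \<Rightarrow> bool"
  assumes base: "P A B F" "card A + card B = r"
    and bip: "\<And>A B F. P A B F \<Longrightarrow> bipartition A B F"
    and step: "\<And>A B F p q. P A B F \<Longrightarrow> p \<noteq> q \<Longrightarrow> {p, q} \<inter> (A \<union> B) = {} \<Longrightarrow>
      P (insert p A) (insert q B) (extend A B F p q)"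
  shows "\<exists>A B F. P A B F \<and> card A + card B = r + 2 * k"
proof (induction k)
  case 0
  then show ?case using base by auto
next
  case (Suc k)
  then obtain A B F where ABF: "P A B F" "card A + card B = r + 2 * k" by blast
  have fin: "finite A" "finite B" using bipartitionD(1,2)[OF bip[OF ABF(1)]] by auto
  then obtain n where n: "\<forall>k\<ge>n. k \<notin> A \<union> B" using fresh_nats[of "A \<union> B"] by auto
  have notin: "n \<notin> A" "n \<notin> B" "Suc n \<notin> A" "Suc n \<notin> B" using n by auto
  have "P (insert n A) (insert (Suc n) B) (extend A B F n (Suc n))"
    using step[OF ABF(1), of n "Suc n"] notin by simp
  moreover have "card (insert n A) + card (insert (Suc n) B) = r + 2 * Suc k"
    using fin notin ABF(2) by simp
  ultimately show ?case by blast
qed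

text \<open>Both nine-vertex graphs were found by a SAT search. The sides are \<open>{0..3}\<close> and \<open>{4..8}\<close>.\<close>

definition edges3 :: "nat \<Rightarrow> nat \<Rightarrow> bool" where
  "edges3 p q \<longleftrightarrow> (min p q, max p q) \<in>
     {(0,1), (0,3), (0,4), (0,5), (0,7), (0,8), (1,3), (1,5), (1,6), (2,5), (2,6), (2,8),
      (3,4), (3,6), (3,8), (4,6), (5,7), (5,8), (6,7)}"

definition edges4 :: "nat \<Rightarrow> nat \<Rightarrow> bool" where
  "edges4 p q \<longleftrightarrow> (min p q, max p q) \<in>
     {(0,3), (0,4), (0,7), (0,8), (1,2), (1,5), (1,7), (1,8), (2,6), (3,4), (3,5), (3,6),
      (5,8), (6,7)}"

lemma bipartition_edges:
  "bipartition {0, 1, 2, 3} {4, 5, 6, 7, 8} edges3"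
  "bipartition {0, 1, 2, 3} {4, 5, 6, 7, 8} edges4"
  unfolding bipartition_def graph_def edges3_def edges4_def
  by (auto simp: min_def max_def split: if_splits)

text \<open>The resulting \<open>graph3\<close> is the 5-cycle.\<close>

lemma core3_small: "core3 {0} {1 :: nat} (\<lambda>_ _. False)"
  by (auto simp: core3_def half3_def bipartition_def graph_def dominates_def)

text \<open>The resulting \<open>graph4\<close> is the 6-cycle.\<close>

lemma core4_small: "core4 {0} {1 :: nat} (\<lambda>_ _. False)"
  by (auto simp: core4_def half4_def bipartition_def graph_def dominates_def)

text \<open>Once \<open>insert_Diff_if\<close> has evaluated \<open>A - {w}\<close>, all quantifiers
  range over explicit sets, and a finite check on numerals remains.\<close>

lemma core3_nine: "core3 {0, 1, 2, 3} {4, 5, 6, 7, 8} edges3"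
  unfolding core3_def half3_def dominates_def
  by (intro conjI bipartition_edges) (simp_all add: insert_Diff_if edges3_def)

lemma core4_nine: "core4 {0, 1, 2, 3} {4, 5, 6, 7, 8} edges4"
  unfolding core4_def half4_def dominates_def
  by (intro conjI bipartition_edges) (simp_all add: insert_Diff_if edges4_def)

lemma core_exists:
  fixes P :: "nat set \<Rightarrow> nat set \<Rightarrow> (nat \<Rightarrow> nat \<Rightarrow> bool) \<Rightarrow> bool"
  assumes two: "P {0} {1} F2" and nine: "P {0, 1, 2, 3} {4, 5, 6, 7, 8} F9"
    and bip: "\<And>A B F. P A B F \<Longrightarrow> bipartition A B F"
    and step: "\<And>A B F p q. P A B F \<Longrightarrow> p \<noteq> q \<Longrightarrow> {p, q} \<inter> (A \<union> B) = {} \<Longrightarrow>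
      P (insert p A) (insert q B) (extend A B F p q)"
    and r: "even r \<and> r \<ge> 2 \<or> odd r \<and> r \<ge> 9"
  shows "\<exists>A B F. P A B F \<and> card A + card B = r"
proof -
  have 2: "\<exists>A B F. P A B F \<and> card A + card B = 2 + 2 * k" for k
    by (rule core_extend_iterate[of P, OF two _ bip step]) simp_all
  have 9: "\<exists>A B F. P A B F \<and> card A + card B = 9 + 2 * k" for k
    by (rule core_extend_iterate[of P, OF nine _ bip step]) simp_all
  have "(\<exists>k. r = 2 + 2 * k) \<or> (\<exists>k. r = 9 + 2 * k)" using r by presburger
  then show ?thesis using 2 9 by metis
qed

lemma core3_exists:
  assumes "even r \<and> r \<ge> 2 \<or> odd r \<and> r \<ge> 9"
  shows "\<exists>A B :: nat set. \<exists>F. core3 A B F \<and> card A + card B = r"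
proof (rule core_exists[of core3, OF core3_small core3_nine _ core3_extend assms])
  show "bipartition A B F" if "core3 A B F" for A B :: "nat set" and F
    using that by (simp add: core3_def)
qed

lemma core4_exists:
  assumes "even r \<and> r \<ge> 2 \<or> odd r \<and> r \<ge> 9"
  shows "\<exists>A B :: nat set. \<exists>F. core4 A B F \<and> card A + card B = r"
proof (rule core_exists[of core4, OF core4_small core4_nine _ core4_extend assms])
  show "bipartition A B F" if "core4 A B F" for A B :: "nat set" and F
    using that by (simp add: core4_def)
qed

section \<open>Gluing a 5-cycle at the root\<close>

definition glue_C5 :: "('a \<Rightarrow> 'a \<Rightarrow> bool) \<Rightarrow> 'a \<Rightarrow> 'a \<Rightarrow> 'a \<Rightarrow> 'a \<Rightarrow> 'a \<Rightarrow> 'a \<Rightarrow> 'a \<Rightarrow> bool" where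
  "glue_C5 E v a x y b p q \<longleftrightarrow> E p q \<or> joined v {a, b} p q \<or> joined x {a, y} p q \<or> joined y {b} p q"

text \<open>The cycle is \<open>v a x y b\<close>. Dominating \<open>x\<close> and \<open>y\<close>
  takes a vertex from \<open>{a, y}\<close> and one from \<open>{x, b}\<close>, so at least two new
  vertices are used. The root condition ensures that the old part still needs \<open>m\<close>
  vertices when it contains \<open>v\<close>.\<close>

lemma good_root_glue_C5:
  assumes root: "good_root m D V E v"
    and fresh: "distinct [a, x, y, b]" "{a, x, y, b} \<inter> V = {}"
  shows "good_root (m + 2) (D + 2) (V \<union> {a, x, y, b}) (glue_C5 E v a x y b) v"
proof -
  let ?W = "V \<union> {a, x, y, b}" and ?E = "glue_C5 E v a x y b"
  have good: "good_graph m D V E" and v: "v \<in> V" "degree V E v = D"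
    and vroot: "\<And>T. T \<subseteq> V \<Longrightarrow> v \<in> T \<Longrightarrow> dominates E T (V - {v}) \<Longrightarrow> m \<le> card T"
    using root unfolding good_root_def by auto
  note g = good_graphD(1)[OF good] and cardV = good_graphD(2)[OF good]
    and deg = good_graphD(3)[OF good] and lower = good_graphD(4)[OF good]
    and crit = good_graphD(5)[OF good]
  have finV: "finite V" and EV: "\<And>p q. E p q \<Longrightarrow> p \<in> V" "\<And>p q. E p q \<Longrightarrow> q \<in> V"
    and sym: "\<And>p q. E p q \<Longrightarrow> E q p" and irr: "\<And>p. \<not> E p p"
    using g unfolding graph_def by auto
  have vne: "v \<noteq> a" "v \<noteq> x" "v \<noteq> y" "v \<noteq> b" using fresh v by auto
  have g': "graph ?W ?E"
    unfolding graph_def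
  proof (intro conjI allI impI)
    show "finite ?W" using finV by simp
    show "p \<in> ?W" "q \<in> ?W" "?E q p" if "?E p q" for p q
      using that EV[of p q] sym[of p q] v by (auto simp: glue_C5_def joined_def)
    show "\<not> ?E p p" for p using irr[of p] vne fresh by (auto simp: glue_C5_def joined_def)
  qed
  have nE: "\<not> E s q" "\<not> E q s" if "s \<in> {a, x, y, b}" for s q
    using EV[of s q] EV[of q s] that fresh by auto
  have nba: "{q. ?E a q} = {v, x}" and nbx: "{q. ?E x q} = {a, y}"
    and nby: "{q. ?E y q} = {x, b}" and nbb: "{q. ?E b q} = {v, y}"
    using fresh vne nE by (auto simp: glue_C5_def joined_def)
  have nbv: "{q. ?E v q} = {q. E v q} \<union> {a, b}"
    using fresh vne by (auto simp: glue_C5_def joined_def)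
  have nbu: "?E u q \<longleftrightarrow> E u q" if "u \<in> V - {v}" for u q
    using fresh vne that by (auto simp: glue_C5_def joined_def)
  have sub: "?E p q" if "E p q" for p q using that by (simp add: glue_C5_def)
  have degv: "degree ?W ?E v = D + 2"
  proof -
    have "{q. E v q} \<inter> {a, b} = {}" using nE by auto
    moreover have "finite {q. E v q}" by (rule finite_subset[OF _ finV]) (use EV in auto)
    ultimately have "card ({q. E v q} \<union> {a, b}) = card {q. E v q} + 2"
      using fresh by (subst card_Un_disjoint) auto
    then show ?thesis using degree_eq_card[OF g'] degree_eq_card[OF g] nbv v by simp
  qed
  have four: "dominates ?E T {a, x, y, b} \<longleftrightarrow>
      (v \<in> T \<or> x \<in> T) \<and> (a \<in> T \<or> y \<in> T) \<and> (x \<in> T \<or> b \<in> T) \<and> (v \<in> T \<or> y \<in> T)" for T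
  proof -
    have "(\<exists>t\<in>T. ?E s t) \<longleftrightarrow> T \<inter> {t. ?E s t} \<noteq> {}" for s by auto
    then show ?thesis unfolding dominates_def by (simp add: nba nbx nby nbb)
  qed
  \<comment> \<open>New vertices have no neighbour in \<open>V - {v}\<close>, so this part is
    dominated by \<open>T \<inter> V\<close> alone.\<close>
  have split: "T \<inter> V \<subseteq> V \<and> dominates E (T \<inter> V) (V - {v}) \<and> (a \<in> T \<or> y \<in> T) \<and> (x \<in> T \<or> b \<in> T) \<and>
      card T = card (T \<inter> V) + card (T \<inter> {a, x, y, b}) \<and> 2 \<le> card (T \<inter> {a, x, y, b})"
    if T: "T \<subseteq> ?W" "dominates ?E T (?W - {v})" for T
  proof -
    have finT: "finite T" using T(1) finV finite_subset[of T ?W] by simp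
    have "dominates E (T \<inter> V) (V - {v})" unfolding dominates_def
    proof
      fix u assume u: "u \<in> V - {v}"
      then obtain t where "t \<in> T" "?E u t" using T(2) unfolding dominates_def by blast
      then show "\<exists>t\<in>T \<inter> V. E u t" using nbu[OF u, of t] EV[of u t] by blast
    qed
    moreover have "dominates ?E T {a, x, y, b}" using T(2) vne unfolding dominates_def by auto
    then have 1: "a \<in> T \<or> y \<in> T" "x \<in> T \<or> b \<in> T" using four by auto
    moreover have "card T = card (T \<inter> V) + card (T \<inter> {a, x, y, b})"
    proof -
      have "card ((T \<inter> V) \<union> (T \<inter> {a, x, y, b})) = card (T \<inter> V) + card (T \<inter> {a, x, y, b})"
        using finT fresh by (intro card_Un_disjoint) auto
      moreover have "(T \<inter> V) \<union> (T \<inter> {a, x, y, b}) = T" using T(1) by blast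
      ultimately show ?thesis by simp
    qed
    moreover have "2 \<le> card (T \<inter> {a, x, y, b})"
    proof -
      obtain s t where "s \<in> {a, y}" "t \<in> {x, b}" "s \<in> T" "t \<in> T" using 1 by blast
      then have "{s, t} \<subseteq> T \<inter> {a, x, y, b}" "s \<noteq> t" using fresh by auto
      then show ?thesis using card_mono[of "T \<inter> {a, x, y, b}" "{s, t}"] by simp
    qed
    ultimately show ?thesis by simp
  qed
  \<comment> \<open>\<open>R\<close> collects the old vertices that \<open>T\<close> may leave
    undominated: \<open>{w}\<close> if the deleted vertex is old, \<open>{v}\<close> if it is
    new.\<close>
  have upper: "\<exists>T\<subseteq>?W - {w}. dominates ?E T (?W - {w}) \<and> card T < m + 2"
    if T: "T \<subseteq> V - {w}" "dominates E T (V - R)" "card T < m" and pq: "p \<in> ?W - {w}" "q \<in> ?W - {w}"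
      and dom: "dominates ?E (T \<union> {p, q}) ({a, x, y, b} - {w} \<union> R - {w})" and R: "w \<in> R \<or> w \<notin> V"
    for T w p q R
  proof (intro exI conjI)
    show "T \<union> {p, q} \<subseteq> ?W - {w}" using T pq by blast
    show "card (T \<union> {p, q}) < m + 2"
      using T(3) card_Un_le[of T "{p, q}"] by (simp add: card_insert_if split: if_splits)
    show "dominates ?E (T \<union> {p, q}) (?W - {w})" unfolding dominates_def
    proof
      fix u assume u: "u \<in> ?W - {w}"
      show "\<exists>t\<in>T \<union> {p, q}. ?E u t"
      proof (cases "u \<in> V - R")
        case True
        then obtain t where "t \<in> T" "E u t" using T(2) unfolding dominates_def by blast
        then show ?thesis using sub[of u t] by blast
      next
        case False
        then have "u \<in> {a, x, y, b} - {w} \<union> R - {w}" using u by blast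
        then show ?thesis using dom unfolding dominates_def by blast
      qed
    qed
  qed
  have "good_graph (m + 2) (D + 2) ?W ?E"
  proof (rule good_graphI[OF g' _ degv])
    show "v \<in> ?W" using v by simp
    show "card ?W = D + 2 + (m + 2)"
    proof -
      have "card ?W = card V + card {a, x, y, b}" using finV fresh by (intro card_Un_disjoint) auto
      then show ?thesis using cardV fresh by simp
    qed
    show "2 \<le> degree ?W ?E u \<and> degree ?W ?E u \<le> D + 2" if u: "u \<in> ?W" for u
    proof (cases "u \<in> V")
      case True
      have "degree ?W ?E u = degree V E u" if "u \<noteq> v"
        using degree_eq_card[OF g'] degree_eq_card[OF g] nbu[of u] True that by simp
      then show ?thesis using deg[OF True] degv by (cases "u = v") auto
    next
      case False
      then have "u \<in> {a, x, y, b}" using u by blast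
      then have "card {q. ?E u q} = 2" using nba nbx nby nbb vne fresh by auto
      then show ?thesis using degree_eq_card[OF g'] by simp
    qed
    show "m + 2 \<le> card T" if T: "T \<subseteq> ?W" "dominates ?E T ?W" for T
    proof -
      have T': "dominates ?E T (?W - {v})" using T(2) unfolding dominates_def by blast
      note sp = split[OF T(1) T']
      have "dominates ?E T {a, x, y, b}" using T(2) unfolding dominates_def by blast
      then have 4: "v \<in> T \<or> x \<in> T" "v \<in> T \<or> y \<in> T" using four by auto
      obtain t where t: "t \<in> T" "?E v t" using T(2) v unfolding dominates_def by blast
      show ?thesis
      proof (cases "v \<in> T")
        case True
        then have "m \<le> card (T \<inter> V)" using vroot[of "T \<inter> V"] sp v by blast
        then show ?thesis using sp by linarith
      next
        case False
        \<comment> \<open>Without \<open>v\<close>, the vertex \<open>a\<close> can only be covered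
          by \<open>x\<close>, and \<open>b\<close> only by \<open>y\<close>.\<close>
        then have xy: "x \<in> T" "y \<in> T" using 4 by auto
        from t(2) consider "E v t" | "t \<in> {a, b}" using nbv by blast
        then show ?thesis
        proof cases
          case 1
          have "dominates E (T \<inter> V) V" unfolding dominates_def
          proof
            fix u assume "u \<in> V"
            then show "\<exists>t\<in>T \<inter> V. E u t"
              using sp t(1) 1 EV(2)[OF 1] by (cases "u = v") (auto simp: dominates_def)
          qed
          then have "m \<le> card (T \<inter> V)" using lower[of "T \<inter> V"] by blast
          then show ?thesis using sp by linarith
        next
          \<comment> \<open>Here a new vertex \<open>t\<close> covers \<open>v\<close>. The old part
            may be one short of \<open>m\<close>, but \<open>t\<close>, \<open>x\<close> and
            \<open>y\<close> are three new vertices.\<close>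
          case 2
          obtain u where u: "u \<in> V" "E v u" using two_neighbours[of V E v] deg[OF v(1)] by blast
          have "dominates E (insert u (T \<inter> V)) V" unfolding dominates_def
          proof
            fix p assume "p \<in> V"
            then show "\<exists>t\<in>insert u (T \<inter> V). E p t"
              using sp u by (cases "p = v") (auto simp: dominates_def)
          qed
          then have "m \<le> card (insert u (T \<inter> V))" using lower[of "insert u (T \<inter> V)"] u by blast
          also have "\<dots> \<le> Suc (card (T \<inter> V))" using finV by (simp add: card_insert_if)
          finally have "m \<le> Suc (card (T \<inter> V))" .
          moreover have "3 \<le> card (T \<inter> {a, x, y, b})"
          proof -
            have "card {t, x, y} = 3" using 2 fresh by auto
            moreover have "{t, x, y} \<subseteq> T \<inter> {a, x, y, b}" using 2 t xy by auto
            ultimately show ?thesis using card_mono[of "T \<inter> {a, x, y, b}" "{t, x, y}"] by simp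
          qed
          ultimately show ?thesis using sp by linarith
        qed
      qed
    qed
    show "\<exists>T\<subseteq>?W - {w}. dominates ?E T (?W - {w}) \<and> card T < m + 2" if w: "w \<in> ?W" for w
    proof (cases "w \<in> V")
      case True
      obtain T where T: "T \<subseteq> V - {w}" "dominates E T (V - {w})" "card T < m" using crit[OF True] by blast
      have wne: "w \<noteq> x" "w \<noteq> y" using True fresh by auto
      have "dominates ?E (T \<union> {x, y}) {a, x, y, b}" unfolding four by blast
      then have "dominates ?E (T \<union> {x, y}) ({a, x, y, b} - {w} \<union> {w} - {w})"
        unfolding dominates_def by blast
      from upper[OF T _ _ this] wne show ?thesis by simp
    next
      case False
      then have wV: "w \<noteq> v" "w \<in> {a, x, y, b}" using v w by auto
      obtain T where T: "T \<subseteq> V - {v}" "dominates E T (V - {v})" "card T < m" using crit[OF v(1)] by blast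
      have Tw: "T \<subseteq> V - {w}" using T(1) False by blast
      \<comment> \<open>Deleting \<open>w\<close> turns the 5-cycle into a path on four vertices,
        \<open>v\<close> among them. Its two inner vertices serve as \<open>p\<close> and
        \<open>q\<close> and cover the whole path; the witness \<open>T\<close> for \<open>v\<close>
        covers the other old vertices.\<close>
      have "\<exists>p\<in>?W - {w}. \<exists>q\<in>?W - {w}. dominates ?E {p, q} (insert v {a, x, y, b} - {w})"
      proof -
        consider "w = a" | "w = b" | "w = x" | "w = y" using wV by blast
        then show ?thesis
        proof cases
          case 1 then show ?thesis using fresh vne
            by (intro bexI[of _ b] bexI[of _ y]) (auto simp: dominates_def glue_C5_def joined_def)
        next
          case 2 then show ?thesis using fresh vne
            by (intro bexI[of _ a] bexI[of _ x]) (auto simp: dominates_def glue_C5_def joined_def)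
        next
          case 3 then show ?thesis using fresh vne v
            by (intro bexI[of _ v] bexI[of _ b]) (auto simp: dominates_def glue_C5_def joined_def)
        next
          case 4 then show ?thesis using fresh vne v
            by (intro bexI[of _ v] bexI[of _ a]) (auto simp: dominates_def glue_C5_def joined_def)
        qed
      qed
      then obtain p q where pq: "p \<in> ?W - {w}" "q \<in> ?W - {w}"
        and dom: "dominates ?E {p, q} (insert v {a, x, y, b} - {w})" by blast
      have "dominates ?E (T \<union> {p, q}) ({a, x, y, b} - {w} \<union> {v} - {w})"
        by (rule dominates_mono[OF dom]) auto
      from upper[OF Tw T(2,3) pq this] False show ?thesis by simp
    qed
  qed
  moreover have "m + 2 \<le> card T" if T: "T \<subseteq> ?W" "v \<in> T \<and> dominates ?E T (?W - {v})" for T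
  proof -
    note sp = split[OF T(1) conjunct2[OF T(2)]]
    have "m \<le> card (T \<inter> V)" using vroot[of "T \<inter> V"] sp v T by blast
    then show ?thesis using sp by linarith
  qed
  ultimately show ?thesis
    unfolding good_root_def using v by (intro conjI allI impI degv) auto
qed

section \<open>Existence for all claimed degrees\<close>

lemma odd_existence:
  assumes "even D \<and> D \<ge> 2 * k + 2 \<or> odd D \<and> D \<ge> 2 * k + 9"
  shows "\<exists>(V :: nat set) E v. good_root (2 * k + 3) D V E v"
  using assms
proof (induction k arbitrary: D)
  case 0
  then have "even D \<and> D \<ge> 2 \<or> odd D \<and> D \<ge> 9" by presburger
  from core3_exists[OF this] obtain A B :: "nat set" and F
    where core: "core3 A B F" "card A + card B = D" by blast
  have "finite (A \<union> B)" using core(1) bipartitionD(1,2)[of A B F] by (simp add: core3_def)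
  then obtain n where n: "\<forall>k\<ge>n. k \<notin> A \<union> B" by (metis fresh_nats)
  have "{n, n + 1, n + 2} \<inter> (A \<union> B) = {}" using n by auto
  moreover have "distinct [n, n + 1, n + 2]" by simp
  ultimately have "good_root 3 D ({n, n + 1, n + 2} \<union> A \<union> B) (graph3 A B F n (n + 1) (n + 2)) n"
    using good_root_graph3[OF core(1), of n "n + 1" "n + 2", unfolded core(2)] by simp
  then show ?case unfolding mult_0_right add_0 by blast
next
  case (Suc k)
  \<comment> \<open>Gluing raises both \<open>m\<close> and the degree by two, so \<open>D\<close>
    and its bounds drop by two together; the bounds also make \<open>D - 2\<close> a genuine
    difference.\<close>
  from Suc.prems have "even (D - 2) \<and> D - 2 \<ge> 2 * k + 2 \<or> odd (D - 2) \<and> D - 2 \<ge> 2 * k + 9"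
    by presburger
  from Suc.IH[OF this] obtain V :: "nat set" and E v where root: "good_root (2 * k + 3) (D - 2) V E v" by blast
  have "finite V" using root unfolding good_root_def good_graph_def graph_def by simp
  then obtain n where n: "\<forall>k\<ge>n. k \<notin> V" by (metis fresh_nats)
  have "{n, n + 1, n + 2, n + 3} \<inter> V = {}"
    using n by auto
  moreover have "distinct [n, n + 1, n + 2, n + 3]" by simp
  ultimately have "good_root (2 * k + 3 + 2) (D - 2 + 2) (V \<union> {n, n + 1, n + 2, n + 3})
      (glue_C5 E v n (n + 1) (n + 2) (n + 3)) v"
    using good_root_glue_C5[OF root, of n "n + 1" "n + 2" "n + 3"] by (simp only:)
  moreover have "2 * k + 3 + 2 = 2 * Suc k + 3" "D - 2 + 2 = D" using Suc.prems by auto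
  ultimately have "good_root (2 * Suc k + 3) D (V \<union> {n, n + 1, n + 2, n + 3})
      (glue_C5 E v n (n + 1) (n + 2) (n + 3)) v" by (simp only:)
  then show ?case by blast
qed

lemma four_existence:
  assumes "even D \<and> D \<ge> 2 \<or> odd D \<and> D \<ge> 9"
  shows "\<exists>(V :: nat set) E. good_graph 4 D V E"
proof -
  obtain A B :: "nat set" and F where core: "core4 A B F" "card A + card B = D"
    using core4_exists[OF assms] by blast
  have "finite (A \<union> B)" using core(1) bipartitionD(1,2)[of A B F] by (simp add: core4_def)
  then obtain n where n: "\<forall>k\<ge>n. k \<notin> A \<union> B" by (metis fresh_nats)
  have "{n, n + 1, n + 2, n + 3} \<inter> (A \<union> B) = {}"
    using n by auto
  moreover have "distinct [n, n + 1, n + 2, n + 3]" by simp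
  ultimately have "good_graph 4 D ({n, n + 1, n + 2, n + 3} \<union> A \<union> B)
      (graph4 A B F n (n + 1) (n + 2) (n + 3))"
    using good_graph_graph4[OF core(1), of n "n + 1" "n + 2" "n + 3", unfolded core(2)] by simp
  then show ?thesis by blast
qed

text \<open>\<open>2 * ((m - 1) div 2)\<close> is \<open>2 * k + 2\<close> for
  \<open>m = 2 * k + 3\<close> and 2 for \<open>m = 4\<close>; adding 7 gives the odd start 9 for
  \<open>m = 3\<close> and \<open>m = 4\<close>.\<close>

lemma good_graph_exists:
  assumes m: "m = 4 \<or> (m \<ge> 3 \<and> odd m)"
    and D: "even D \<and> D \<ge> 2 * ((m - 1) div 2) \<or> odd D \<and> D \<ge> 2 * ((m - 1) div 2) + 7"
  shows "\<exists>(V :: nat set) E. good_graph m D V E"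
proof (cases "m = 4")
  case True
  then show ?thesis using four_existence[of D] D by simp
next
  case False
  then have "\<exists>k. m = 2 * k + 3" using m by presburger
  then obtain k where k: "m = 2 * k + 3" ..
  then have "(m - 1) div 2 = k + 1" by simp
  then have "even D \<and> D \<ge> 2 * k + 2 \<or> odd D \<and> D \<ge> 2 * k + 9" using D by presburger
  from odd_existence[OF this] obtain V :: "nat set" and E v where "good_root m D V E v"
    unfolding k by blast
  then show ?thesis unfolding good_root_def by blast
qed

theorem theorem2:
  fixes m :: nat
  assumes "m \<ge> 1"
  shows "((\<exists>D (V :: 'a set) E. good_graph m D V E) \<longrightarrow> (m = 4 \<or> (m \<ge> 3 \<and> odd m)))
    \<and> ((m = 4 \<or> (m \<ge> 3 \<and> odd m)) \<longrightarrow>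
        (\<forall>D. D < 2 * ((m - 1) div 2) \<longrightarrow> \<not> (\<exists>(V :: 'a set) E. good_graph m D V E))
      \<and> (\<forall>D. even D \<and> D \<ge> 2 * ((m - 1) div 2) \<longrightarrow> (\<exists>(V :: nat set) E. good_graph m D V E))
      \<and> (\<forall>D. odd D \<and> D \<ge> 2 * ((m - 1) div 2) + 7 \<longrightarrow> (\<exists>(V :: nat set) E. good_graph m D V E)))"
proof (intro conjI impI allI)
  show "m = 4 \<or> (m \<ge> 3 \<and> odd m)" if "\<exists>D (V :: 'a set) E. good_graph m D V E"
    using that good_graph_parameters[OF _ assms] by blast
  show "\<not> (\<exists>(V :: 'a set) E. good_graph m D V E)" if "D < 2 * ((m - 1) div 2)" for D
  proof
    assume "\<exists>(V :: 'a set) E. good_graph m D V E"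
    then have par: "D \<ge> 2 \<and> (m = 4 \<or> (m \<ge> 3 \<and> odd m \<and> m - 1 \<le> D))"
      using good_graph_parameters[OF _ assms] by blast
    \<comment> \<open>For odd \<open>m\<close> the bound is \<open>m - 1\<close>; for
      \<open>m = 4\<close> it is 2, and \<open>D \<ge> 2\<close> comes from the minimum
      degree.\<close>
    then show False
    proof (cases "m = 4")
      case True then show ?thesis using that par by simp
    next
      case False then show ?thesis using that par by presburger
    qed
  qed
  show "\<exists>(V :: nat set) E. good_graph m D V E"
    if "m = 4 \<or> (m \<ge> 3 \<and> odd m)" "even D \<and> D \<ge> 2 * ((m - 1) div 2)" for D
    using good_graph_exists[OF that(1)] that(2) by blast
  show "\<exists>(V :: nat set) E. good_graph m D V E"
    if "m = 4 \<or> (m \<ge> 3 \<and> odd m)" "odd D \<and> D \<ge> 2 * ((m - 1) div 2) + 7" for D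
    using good_graph_exists[OF that(1)] that(2) by blast
qed

end
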